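(* Let $N \geq 3$, $p \in (1,N)$ and let $E$ be a closed set in $\mathbb{R}^N$ with Assouad dimension $\dim_A(E)=d<N$. Then, for every $a \in \left(-\frac{(N-d)(p-1)}{p},\frac{(N-p)(N-d)}{Np}\right)$, there exists $C>0$ such that $$\int_{\mathbb{R}^N} \frac{|u|^p}{\delta_E^{p(a+1)}} \log \left(\delta_E^{N-p-pa} |u|^p\right) dx \leq \frac{N}{p} \log \left(C \int_{\mathbb{R}^N} \frac{|\nabla u|^p}{\delta_E^{pa}} \, dx \right)$$ for all $u \in C_c^{\infty}(\mathbb{R}^N)$ with $\int_{\mathbb{R}^N} \frac{|u|^p}{\delta_E^{p(a+1)}}\,dx =1$.
   Context: For a (nonempty) closed set $E\subset\mathbb{R}^N$, $\delta_E(x)$ denotes the distance from $x$ to $E$. For $E\subset\mathbb{R}^N$, let $\eta(E,r)$ be the minimal number of open balls of radius $r$ with centers in $E$ needed to cover $E$. The Assouad dimension is $$\dim_A(E)= \inf \left\{\lambda \geq 0: \exists\, C_\lambda > 0 \text{ such that } \eta(E \cap B_R(x),r) \leq C_\lambda \left(\tfrac{r}{R} \right)^{-\lambda} \ \forall x \in E,\ 0<r<R< \mathrm{diam}(E) \right\},$$ where, if $\mathrm{diam}(E)=0$, the restriction $R<\mathrm{diam}(E)$ is removed. The convention $0\log 0=0$ is used. *)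

theory Defs
  imports "HOL-Analysis.Analysis"
begin

subsection \<open>Assouad dimension\<close>

text \<open>The minimal number of open balls of radius \<open>r\<close> with centers in \<open>E\<close> needed to cover \<open>E\<close>;
  it is \<open>\<infinity>\<close> if no finite family of such balls covers \<open>E\<close>.\<close>

definition covering_number :: "'a::metric_space set \<Rightarrow> real \<Rightarrow> enat" where
  "covering_number E r = (INF F \<in> {F. finite F \<and> F \<subseteq> E \<and> E \<subseteq> (\<Union>x\<in>F. ball x r)}. enat (card F))"

text \<open>The library constant \<^const>\<open>diameter\<close> is real-valued and therefore unspecified on unbounded sets;
  here unbounded sets have diameter \<open>\<infinity>\<close>.\<close>

definition ext_diameter :: "'a::metric_space set \<Rightarrow> ereal" where
  "ext_diameter E = (SUP x\<in>E. SUP y\<in>E. ereal (dist x y))"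

definition assouad_dim :: "'a::metric_space set \<Rightarrow> ereal" where
  "assouad_dim E = Inf (ereal ` {s. 0 \<le> s \<and> (\<exists>C>0. \<forall>x\<in>E. \<forall>r R.
     0 < r \<and> r < R \<and> (ext_diameter E = 0 \<or> ereal R < ext_diameter E) \<longrightarrow>
       ereal_of_enat (covering_number (E \<inter> ball x R) r) \<le> ereal (C * (r / R) powr (- s)))})"


subsection \<open>Smooth compactly supported functions\<close>

primrec C_k :: "nat \<Rightarrow> ('a::euclidean_space \<Rightarrow> real) \<Rightarrow> bool" where
  "C_k 0 f \<longleftrightarrow> continuous_on UNIV f"
| "C_k (Suc k) f \<longleftrightarrow> (\<forall>x. f differentiable (at x)) \<and>
     (\<forall>i\<in>Basis. C_k k (\<lambda>x. frechet_derivative f (at x) i))"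

definition Cc_infinity :: "('a::euclidean_space \<Rightarrow> real) set" where
  "Cc_infinity = {u. (\<forall>k. C_k k u) \<and> compact (closure {x. u x \<noteq> 0})}"

definition grad :: "('a::euclidean_space \<Rightarrow> real) \<Rightarrow> 'a \<Rightarrow> 'a" where
  "grad u x = (THE D. GDERIV u x :> D)"


subsection \<open>Integrals and logarithms with extended values\<close>

text \<open>The Lebesgue integral with values in \<open>[-\<infinity>, \<infinity>]\<close>. Unlike the Bochner integral, it does not
  silently become \<open>0\<close> for non-integrable functions. Should both parts be infinite, then its
  value is \<open>\<infinity> - \<infinity> = \<infinity>\<close>, so that an upper bound by a finite number
  includes the claim that the positive part is integrable.\<close>

definition ext_integral :: "('a::euclidean_space \<Rightarrow> real) \<Rightarrow> ereal" where
  "ext_integral f = enn2ereal (\<integral>\<^sup>+ x. ennreal (f x) \<partial>lborel) - enn2ereal (\<integral>\<^sup>+ x. ennreal (- f x) \<partial>lborel)"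

text \<open>The logarithm on \<open>[0, \<infinity>]\<close>; negative arguments are irrelevant.\<close>

definition ext_ln :: "ereal \<Rightarrow> ereal" where
  "ext_ln t = (if t \<le> 0 then - \<infinity> else if t = \<infinity> then \<infinity> else ereal (ln (real_of_ereal t)))"

end

theory Submission
  imports Defs
begin

text \<open>
Write \<open>\<delta>\<close> for the distance to \<open>E\<close> and put \<open>q = Np/(N - p)\<close>, \<open>f = |u|^p / \<delta>^(p(a+1))\<close> and
\<open>w = \<delta>^(N-p-pa) |u|^p\<close>, so that \<open>f\<close> is a probability density and the left-hand side is the integral of
\<open>f ln w\<close>. The power of \<open>\<delta>\<close> in \<open>w\<close> is exactly the one for which
\<open>f w^(p/(N-p)) = (|u| \<delta>^(-a))^q\<close>. Jensen's inequality (\<open>entropy_le_log_power\<close>) thus bounds the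
left-hand side by \<open>(N-p)/p\<close> times the logarithm of the integral of \<open>(|u| \<delta>^(-a))^q\<close>, and the theorem is
the logarithm of the weighted Sobolev inequality
\<open>\<parallel>u \<delta>^(-a)\<parallel>\<^sub>q \<le> C \<parallel>|\<nabla>u| \<delta>^(-a)\<parallel>\<^sub>p\<close> (\<open>weighted_sobolev\<close>), since \<open>(N-p)/p \<cdot> q/p = N/p\<close>.

For the Sobolev inequality, averaging the fundamental theorem of calculus over all rays from \<open>x\<close> bounds
\<open>|u(x)|\<close> by the integral over \<open>t > 0\<close> of the averages of \<open>|\<nabla>u|\<close> over the balls \<open>B(x,t)\<close>
(\<open>gradient_average_bound\<close>). For \<open>y\<close> in \<open>B(x,t)\<close> the weights compare by the triangle inequality: if
\<open>a \<ge> 0\<close>, then \<open>(\<delta>(y)/\<delta>(x))^a \<le> (1 + t/\<delta>(x))^a\<close>, and if \<open>a < 0\<close>, then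
\<open>(\<delta>(x)/\<delta>(y))^|a| \<le> (1 + t/\<delta>(y))^|a|\<close>. After pairing with a test function both cases lead to the same
bilinear form in which one function is averaged and the other one carries the factor \<open>(1 + t/\<delta>)^|a|\<close>;
only the roles of the gradient and of the test function, and with them the Lebesgue exponents, are
exchanged. The two bounds on \<open>a\<close> say that the \<open>q\<close>-th, respectively the \<open>p/(p-1)\<close>-th, power of that
factor has an exponent below \<open>N - d\<close>. By a volume estimate for the tubes around \<open>E\<close>, this makes its mean
over balls of radius \<open>t\<close> bounded (\<open>distance_weight_ball_integral\<close>). The same volume estimate shows that
\<open>E\<close> is a null set, so that dividing by powers of \<open>\<delta>\<close> is harmless.

The bilinear form is bounded without maximal functions (\<open>weighted_fractional_integral_bilinear\<close>). For each
order of smoothing \<open>\<beta> > 0\<close> and the matching exponent \<open>\<sigma>\<close>, an \<open>L^\<sigma>\<close> bound with respect to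
\<open>dx dt/t\<close> holds, because at scale \<open>t\<close> the function may be split at the height \<open>t^(-N/r)\<close>
(\<open>scale_estimate\<close>). The bilinear form needs an \<open>L^1\<close> norm over the scales instead, for order 1. It is
recovered from the \<open>L^\<sigma>\<close> bounds for orders slightly above and slightly below 1: for each \<open>x\<close> the scales are
split at the point where the two estimates balance (\<open>scale_interpolation\<close>).
\<close>

section \<open>Distance weights and the Assouad dimension\<close>

lemma Inf_enat_in: "A \<noteq> {} \<Longrightarrow> Inf A \<in> (A :: enat set)"
  unfolding Inf_enat_def by (auto intro: LeastI)

lemma covering_number_le_obtains:
  fixes E :: "'a::metric_space set"
  assumes "ereal_of_enat (covering_number E r) \<le> ereal c"
  obtains F where "finite F" "F \<subseteq> E" "E \<subseteq> (\<Union>x\<in>F. ball x r)" "real (card F) \<le> c"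
proof -
  let ?A = "(\<lambda>F. enat (card F)) ` {F. finite F \<and> F \<subseteq> E \<and> E \<subseteq> (\<Union>x\<in>F. ball x r)}"
  have "?A \<noteq> {}"
  proof
    assume "?A = {}"
    then have "covering_number E r = \<infinity>"
      unfolding covering_number_def by (simp add: Inf_enat_def)
    with assms show False by simp
  qed
  then have "Inf ?A \<in> ?A" by (rule Inf_enat_in)
  then obtain F where F: "finite F" "F \<subseteq> E" "E \<subseteq> (\<Union>x\<in>F. ball x r)"
    and eq: "covering_number E r = enat (card F)"
    unfolding covering_number_def by auto
  have "real (card F) \<le> c" using assms unfolding eq by simp
  with F that show ?thesis by blast
qed

lemma dist_le_ext_diameter: "x \<in> E \<Longrightarrow> y \<in> E \<Longrightarrow> ereal (dist x y) \<le> ext_diameter E"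
  unfolding ext_diameter_def by (meson SUP_upper2 order_refl)

text \<open>The definition only controls radii below the diameter. A bounded \<open>E\<close> is compact, hence a finite union of
pieces of half its diameter; covering these pieces gives the estimate for all radii at the price of a larger
constant.\<close>

lemma assouad_covering:
  fixes E :: "'a::euclidean_space set" and l :: real
  assumes E: "closed E" "E \<noteq> {}" and dim: "assouad_dim E < ereal l"
  shows "\<exists>s C. 0 \<le> s \<and> s < l \<and> 0 < C \<and> (\<forall>x r R. x \<in> E \<longrightarrow> 0 < r \<longrightarrow> r < R \<longrightarrow>
    (\<exists>F. finite F \<and> real (card F) \<le> C * (R / r) powr s \<and> E \<inter> ball x R \<subseteq> (\<Union>z\<in>F. ball z r)))"
proof -
  obtain s C0 where s: "0 \<le> s" "s < l" and C0: "C0 > 0"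
    and cov0: "\<And>x r R. x \<in> E \<Longrightarrow> 0 < r \<and> r < R \<and> (ext_diameter E = 0 \<or> ereal R < ext_diameter E) \<Longrightarrow>
       ereal_of_enat (covering_number (E \<inter> ball x R) r) \<le> ereal (C0 * (r / R) powr (- s))"
    using dim unfolding assouad_dim_def Inf_less_iff by fastforce
  have cov: "\<exists>F. finite F \<and> real (card F) \<le> C0 * (R / r) powr s \<and> E \<inter> ball x R \<subseteq> (\<Union>z\<in>F. ball z r)"
    if "x \<in> E" "0 < r" "r < R" "ext_diameter E = 0 \<or> ereal R < ext_diameter E" for x r R
  proof -
    have "(r / R) powr (- s) = (R / r) powr s"
      using that by (simp add: powr_minus powr_divide field_simps)
    then show ?thesis
      using covering_number_le_obtains[OF cov0[of x r R]] that by metis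
  qed
  consider (full) "ext_diameter E = 0 \<or> ext_diameter E = \<infinity>"
    | (bdd) D where "ext_diameter E = ereal D" "D > 0"
  proof -
    obtain e where "e \<in> E" using E by blast
    then have "0 \<le> ext_diameter E" using dist_le_ext_diameter[of e E e] by (simp add: zero_ereal_def)
    then show ?thesis using that by (cases "ext_diameter E") (auto simp: order_le_less)
  qed
  then show ?thesis
  proof cases
    case full
    with cov s C0 show ?thesis by (intro exI[of _ s] exI[of _ C0]) auto
  next
    case (bdd D)
    have "compact E"
    proof -
      obtain e where e: "e \<in> E" using E by blast
      have "bounded E"
        unfolding bounded_def using dist_le_ext_diameter[OF e, unfolded bdd] by auto
      with E show ?thesis by (simp add: compact_eq_bounded_closed)
    qed
    then obtain K where K: "K \<subseteq> E" "finite K" "E \<subseteq> (\<Union>x\<in>K. ball x (D/2))"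
      by (rule compactE_image[of E E "\<lambda>x. ball x (D/2)"]) (use bdd in auto)
    define M where "M = real (card K)"
    define C where "C = C0 + M + M * C0"
    have M0: "M \<ge> 0" unfolding M_def by simp
    have C: "C0 \<le> C" "M \<le> C" "M * C0 \<le> C" "C > 0"
      unfolding C_def using C0 M0 by (auto intro!: add_nonneg_nonneg add_pos_nonneg)
    have "\<exists>F. finite F \<and> real (card F) \<le> C * (R / r) powr s \<and> E \<inter> ball x R \<subseteq> (\<Union>z\<in>F. ball z r)"
      if x: "x \<in> E" and r: "0 < r" "r < R" for x r R
    proof -
      have ge1: "1 \<le> (R / r) powr s" using r s by (simp add: ge_one_powr_ge_zero)
      consider "R < D" | "R \<ge> D" "r < D/2" | "R \<ge> D" "r \<ge> D/2" by linarith
      then show ?thesis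
      proof cases
        case 1
        then obtain F where F: "finite F" "real (card F) \<le> C0 * (R / r) powr s" "E \<inter> ball x R \<subseteq> (\<Union>z\<in>F. ball z r)"
          using cov[OF x r] bdd by auto
        have "C0 * (R / r) powr s \<le> C * (R / r) powr s" using C by (intro mult_right_mono) auto
        with F show ?thesis by (meson order_trans)
      next
        case 2
        have "\<forall>z\<in>K. \<exists>F. finite F \<and> real (card F) \<le> C0 * (D/2 / r) powr s \<and> E \<inter> ball z (D/2) \<subseteq> (\<Union>w\<in>F. ball w r)"
          using K r 2 bdd by (intro ballI cov) auto
        then obtain F where F: "\<And>z. z \<in> K \<Longrightarrow> finite (F z)"
          "\<And>z. z \<in> K \<Longrightarrow> real (card (F z)) \<le> C0 * (D/2 / r) powr s"
          "\<And>z. z \<in> K \<Longrightarrow> E \<inter> ball z (D/2) \<subseteq> (\<Union>w\<in>F z. ball w r)" by metis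
        have "real (card (\<Union>z\<in>K. F z)) \<le> (\<Sum>z\<in>K. real (card (F z)))"
          using card_UN_le[OF K(2), of F] by (simp flip: of_nat_sum)
        also have "\<dots> \<le> M * (C0 * (D/2 / r) powr s)"
          unfolding M_def by (intro sum_bounded_above F)
        also have "\<dots> \<le> M * (C0 * (R / r) powr s)"
          using r 2 s C0 M0 bdd by (intro mult_left_mono powr_mono2) (auto simp: divide_simps)
        also have "\<dots> \<le> C * (R / r) powr s"
          using C(3) by (simp add: mult.assoc[symmetric] mult_right_mono)
        finally have "real (card (\<Union>z\<in>K. F z)) \<le> C * (R / r) powr s" .
        moreover have "E \<inter> ball x R \<subseteq> (\<Union>w\<in>(\<Union>z\<in>K. F z). ball w r)"
          using K(3) F(3) by blast
        ultimately show ?thesis using K F by (intro exI[of _ "\<Union>z\<in>K. F z"]) auto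
      next
        case 3
        have "M \<le> C * (R / r) powr s"
          using mult_mono[OF C(2) ge1] C M0 by simp
        moreover have "E \<inter> ball x R \<subseteq> (\<Union>z\<in>K. ball z r)"
        proof
          fix w assume "w \<in> E \<inter> ball x R"
          then obtain z where "z \<in> K" "dist z w < D/2" using K(3) by auto
          then show "w \<in> (\<Union>z\<in>K. ball z r)" using 3 by force
        qed
        ultimately show ?thesis using K unfolding M_def by blast
      qed
    qed
    with s C show ?thesis by (intro exI[of _ s] exI[of _ C]) auto
  qed
qed

lemma borel_measurable_infdist [measurable]: "(\<lambda>x::'a::euclidean_space. infdist x E) \<in> borel_measurable borel"
  by (intro borel_measurable_continuous_onI continuous_intros)

lemma sets_tube [measurable]: "{x \<in> ball y R. infdist x E < r} \<in> sets (borel :: 'a::euclidean_space measure)"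
proof -
  have "{x \<in> ball y R. infdist x E < r} = ball y R \<inter> {x. infdist x E < r}" by auto
  then show ?thesis by simp
qed

text \<open>Each point of the tube lies within \<open>r\<close> of a point of \<open>E\<close> in a ball of comparable radius \<open>R\<close>, so doubling
the radii of a cover of that part of \<open>E\<close> covers the tube.\<close>

lemma tubular_volume:
  fixes E :: "'a::euclidean_space set" and l :: real
  assumes E: "closed E" "E \<noteq> {}" and dim: "assouad_dim E < ereal l"
  shows "\<exists>s C. 0 \<le> s \<and> s < l \<and> 0 < C \<and> (\<forall>y r R. 0 < r \<longrightarrow> r \<le> R \<longrightarrow>
      emeasure lborel {x \<in> ball y R. infdist x E < r} \<le> ennreal (C * R powr s * r powr (real DIM('a) - s)))"
proof -
  obtain s C :: real where s: "0 \<le> s" "s < l" "0 < C"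
   and cov: "\<And>x r R. \<lbrakk>x \<in> E; 0 < r; r < R\<rbrakk> \<Longrightarrow>
       \<exists>F. finite F \<and> real (card F) \<le> C * (R / r) powr s \<and> E \<inter> ball x R \<subseteq> (\<Union>z\<in>F. ball z r)"
    using assouad_covering[OF assms] by blast
  define v where "v = unit_ball_vol (real DIM('a))"
  have v: "v > 0" unfolding v_def by (simp add: unit_ball_vol_pos)
  define C' where "C' = C * 4 powr s * v * 2 ^ DIM('a)"
  have bound: "emeasure lborel {x \<in> ball y R. infdist x E < r} \<le> ennreal (C' * R powr s * r powr (real DIM('a) - s))"
    if r: "0 < r" "r \<le> R" for y :: 'a and r R
  proof (cases "\<exists>e0\<in>E. dist y e0 < 2 * R")
    case True
    then obtain e0 where e0: "e0 \<in> E" "dist y e0 < 2 * R" by blast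
    obtain F where F: "finite F" "real (card F) \<le> C * (4 * R / r) powr s" "E \<inter> ball e0 (4*R) \<subseteq> (\<Union>z\<in>F. ball z r)"
      using cov[of e0 r "4*R"] e0 r by auto
    have "{x \<in> ball y R. infdist x E < r} \<subseteq> (\<Union>z\<in>F. ball z (2*r))"
    proof
      fix x assume x: "x \<in> {x \<in> ball y R. infdist x E < r}"
      obtain e where e: "e \<in> E" "infdist x E = dist x e"
        using infdist_attains_inf[OF E] by blast
      have "dist x e < r" "dist y x < R" using x e by auto
      then have "dist y e < 2 * R" using dist_triangle[of y e x] r by simp
      then have "dist e0 e < 4 * R" using dist_triangle2[of e0 e y] e0 by (simp add: dist_commute)
      then obtain z where "z \<in> F" "dist z e < r" using F(3) e by auto
      then have "dist z x < 2 * r" using \<open>dist x e < r\<close> dist_triangle2[of z x e] by simp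
      with \<open>z \<in> F\<close> show "x \<in> (\<Union>z\<in>F. ball z (2*r))" by auto
    qed
    then have "emeasure lborel {x \<in> ball y R. infdist x E < r} \<le> emeasure lborel (\<Union>z\<in>F. ball z (2*r))"
      using F(1) by (intro emeasure_mono) (auto intro!: borel_open)
    also have "\<dots> \<le> (\<Sum>z\<in>F. emeasure lborel (ball z (2*r)))"
      using F(1) by (intro emeasure_subadditive_finite) auto
    also have "\<dots> = ennreal (real (card F) * (v * (2*r)^DIM('a)))"
      using r v by (simp add: emeasure_ball v_def ennreal_mult ennreal_of_nat_eq_real_of_nat)
    also have "\<dots> \<le> ennreal ((C * (4 * R / r) powr s) * (v * (2*r)^DIM('a)))"
      using F r v by (intro ennreal_leI mult_right_mono) auto
    also have "(C * (4 * R / r) powr s) * (v * (2*r)^DIM('a)) = C' * R powr s * r powr (real DIM('a) - s)"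
      using r unfolding C'_def by (simp add: powr_divide powr_mult powr_diff powr_realpow power_mult_distrib)
    finally show ?thesis .
  next
    case False
    have "{x \<in> ball y R. infdist x E < r} = {}"
    proof (rule ccontr)
      assume "{x \<in> ball y R. infdist x E < r} \<noteq> {}"
      then obtain x where x: "dist y x < R" "infdist x E < r" by auto
      obtain e where e: "e \<in> E" "infdist x E = dist x e"
        using infdist_attains_inf[OF E] by blast
      then have "dist y e < 2 * R" using dist_triangle[of y e x] r x by simp
      with e False show False by blast
    qed
    then show ?thesis by (simp only: emeasure_empty zero_le)
  qed
  have "C' > 0" using s v unfolding C'_def by simp
  with s bound show ?thesis by (intro exI[of _ s] exI[of _ C']) auto
qed

lemma null_set_of_assouad_dim_less:
  fixes E :: "'a::euclidean_space set"
  assumes E: "closed E" "E \<noteq> {}" and dim: "assouad_dim E < ereal DIM('a)"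
  shows "E \<in> null_sets lborel"
proof -
  obtain s C :: real where s: "0 \<le> s" "s < DIM('a)" "0 < C"
    and vol: "\<And>y r R. \<lbrakk>0 < r; r \<le> R\<rbrakk> \<Longrightarrow>
      emeasure lborel {x \<in> ball (y::'a) R. infdist x E < r} \<le> ennreal (C * R powr s * r powr (real DIM('a) - s))"
    using tubular_volume[OF assms] by blast
  have [measurable]: "E \<in> sets borel" using E by auto
  have *: "emeasure lborel (E \<inter> ball 0 (real k)) = 0" for k
  proof (cases "k = 0")
    case False
    have lim: "((\<lambda>r. C * real k powr s * r powr (real DIM('a) - s)) \<longlongrightarrow> 0) (at_right 0)"
      using s by (auto intro!: tendsto_eq_intros tendsto_powr2 simp: eventually_at_filter)
    have "((\<lambda>r. ennreal (C * real k powr s * r powr (real DIM('a) - s))) \<longlongrightarrow> ennreal 0) (at_right 0)"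
      by (intro tendsto_ennrealI lim)
    moreover have "eventually (\<lambda>r. emeasure lborel (E \<inter> ball 0 (real k)) \<le> ennreal (C * real k powr s * r powr (real DIM('a) - s))) (at_right 0)"
    proof -
      have "emeasure lborel (E \<inter> ball 0 (real k)) \<le> ennreal (C * real k powr s * r powr (real DIM('a) - s))"
        if "0 < r" "r < 1" for r
      proof -
        have "emeasure lborel (E \<inter> ball 0 (real k)) \<le> emeasure lborel {x \<in> ball (0::'a) (real k). infdist x E < r}"
          using that by (intro emeasure_mono subsetI, simp_all only: sets_lborel sets_tube) auto
        also have "\<dots> \<le> ennreal (C * real k powr s * r powr (real DIM('a) - s))"
          using that False by (intro vol) auto
        finally show ?thesis .
      qed
      then show ?thesis by (auto simp: eventually_at_right_field intro!: exI[of _ 1])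
    qed
    ultimately have "emeasure lborel (E \<inter> ball 0 (real k)) \<le> ennreal 0"
      by (rule tendsto_lowerbound) auto
    then show ?thesis by simp
  qed simp
  have "E = (\<Union>k. E \<inter> ball 0 (real k))"
    by (auto simp: reals_Archimedean2)
  moreover have "(\<Union>k. E \<inter> ball 0 (real k)) \<in> null_sets lborel"
    using * by (intro null_sets_UN) auto
  ultimately show ?thesis by simp
qed

text \<open>The level sets of the weight inside the ball are the tubes of width \<open>t / 2^j\<close>, on which the weight is about
\<open>2^(jg)\<close> and whose volume is at most \<open>C t^n 2^(-j(n-s))\<close>. Since some \<open>s < n - g\<close> is admissible, summing over
\<open>j\<close> gives a geometric series.\<close>

lemma distance_weight_ball_integral:
  fixes E :: "'a::euclidean_space set" and g :: real
  assumes E: "closed E" "E \<noteq> {}" and dim: "assouad_dim E < ereal (real DIM('a) - g)" and g: "0 \<le> g"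
  obtains K :: real where "0 < K"
    "\<And>y t. 0 < t \<Longrightarrow>
      (\<integral>\<^sup>+x. ennreal ((1 + t / infdist x E) powr g) * indicator (ball y t) x \<partial>lborel) \<le> ennreal (K * t ^ DIM('a))"
proof -
  obtain s C :: real where s: "0 \<le> s" "s < real DIM('a) - g" "0 < C"
    and vol: "\<And>y r R. \<lbrakk>0 < r; r \<le> R\<rbrakk> \<Longrightarrow>
      emeasure lborel {x \<in> ball (y::'a) R. infdist x E < r} \<le> ennreal (C * R powr s * r powr (real DIM('a) - s))"
    using tubular_volume[OF E dim] by blast
  define v where "v = unit_ball_vol (real DIM('a))"
  have v: "v > 0" unfolding v_def by (simp add: unit_ball_vol_pos)
  define q where "q = 2 powr (g + s - real DIM('a))"
  have q: "0 < q" "q < 1" unfolding q_def using s by (auto simp: powr_less_one)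
  define K where "K = 2 powr g * v + 4 powr g * C * (1 / (1 - q))"
  have "K > 0" unfolding K_def using v s q by (intro add_pos_pos) auto
  moreover have "(\<integral>\<^sup>+x. ennreal ((1 + t / infdist x E) powr g) * indicator (ball y t) x \<partial>lborel) \<le> ennreal (K * t ^ DIM('a))"
    if t: "0 < t" for y t
  proof -
    define A where "A j = {x \<in> ball y t. infdist x E < t / 2 ^ j}" for j :: nat
    have A_meas[measurable]: "A j \<in> sets borel" for j
      unfolding A_def by (rule sets_tube)
    have pw: "ennreal ((1 + t / infdist x E) powr g) * indicator (ball y t) x
        \<le> ennreal (2 powr g) * indicator (ball y t) x + (\<Sum>j. ennreal (2 powr (g * (real j + 2))) * indicator (A j) x)"
      (is "?L \<le> ?R + ?S")
      for x
    proof (cases "x \<in> ball y t")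
      case xin: True
      let ?d = "infdist x E"
      show ?thesis
    proof (cases "t \<le> ?d \<or> ?d = 0")
        case True
        then have "1 + t / ?d \<le> 2" using t by (auto simp: field_simps)
        then have "(1 + t / ?d) powr g \<le> 2 powr g"
          using t g by (intro powr_mono2) (auto simp: infdist_nonneg add_nonneg_nonneg)
        then have "?L \<le> ?R" by (auto simp: indicator_def ennreal_leI)
        then show ?thesis by (rule add_increasing2[OF zero_le])
      next
        case False
        then have d: "0 < ?d" "?d < t" using infdist_nonneg[of x E] by auto
        \<comment> \<open>the level with \<open>2^j < t / \<delta>(x) \<le> 2^(j+1)\<close>; the strict inequality on the left puts \<open>x\<close> into the open tube \<open>A j\<close>\<close>
        define j where "j = nat (\<lceil>log 2 (t / ?d)\<rceil> - 1)"
        have "log 2 (t/?d) > 0" using d t by simp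
        then have j: "real j < log 2 (t / ?d)" "log 2 (t / ?d) \<le> real j + 1"
          unfolding j_def by linarith+
        have j1: "2 ^ j < t / ?d"
          using j(1) d t by (simp add: less_log_iff powr_realpow)
        have j2: "t / ?d \<le> 2 * 2 ^ j"
          using j(2) d t by (simp add: log_le_iff powr_add powr_realpow)
        have "(2::real) ^ (j + 2) = 2 * 2 ^ j + 2 * 2 ^ j" by (simp add: power_add)
        then have "1 + t / ?d \<le> 2 ^ (j + 2)" using j2 one_le_power[of "2::real" j] by linarith
        then have "(1 + t / ?d) powr g \<le> (2 ^ (j+2)) powr g"
          using t g d by (intro powr_mono2) auto
        also have "\<dots> = 2 powr (g * real (j + 2))"
          by (simp only: powr_realpow[symmetric] powr_powr zero_less_numeral mult.commute)
        finally have le1: "(1 + t / ?d) powr g \<le> 2 powr (g * (real j + 2))" by (simp add: add.commute)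
        have "x \<in> A j" unfolding A_def using xin j1 d t by (auto simp: field_simps)
        define f where "f j = ennreal (2 powr (g * (real j + 2))) * indicator (A j) x" for j
        have "?L = ennreal ((1 + t / ?d) powr g)" using xin by simp
        also have "\<dots> \<le> ennreal (2 powr (g * (real j + 2)))" by (rule ennreal_leI[OF le1])
        also have "\<dots> = f j" unfolding f_def using \<open>x \<in> A j\<close> by simp
        also have "f j \<le> (\<Sum>j. f j)"
          using sum_le_suminf[of f "{j}"] by simp
        also have "\<dots> = ?S" unfolding f_def ..
        finally show ?thesis by (rule add_increasing[OF zero_le])
      qed
    qed simp
    have term_j: "ennreal (2 powr (g * (real j + 2))) * emeasure lborel (A j)
        \<le> ennreal (4 powr g * C * t ^ DIM('a) * q ^ j)" for j
    proof -
      have "emeasure lborel (A j) \<le> ennreal (C * t powr s * (t / 2 ^ j) powr (real DIM('a) - s))"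
        unfolding A_def using t by (intro vol) (auto simp: field_simps)
      then have "ennreal (2 powr (g * (real j + 2))) * emeasure lborel (A j)
          \<le> ennreal (2 powr (g * (real j + 2))) * ennreal (C * t powr s * (t / 2 ^ j) powr (real DIM('a) - s))"
        by (intro mult_left_mono) auto
      also have "\<dots> = ennreal (2 powr (g * (real j + 2)) * (C * t powr s * (t / 2 ^ j) powr (real DIM('a) - s)))"
        using s t by (intro ennreal_mult[symmetric]) auto
      also have "2 powr (g * (real j + 2)) * (C * t powr s * (t / 2 ^ j) powr (real DIM('a) - s)) = 4 powr g * C * t ^ DIM('a) * q ^ j"
      proof -
        have 1: "2 powr (g * (real j + 2)) = 2 powr (g * j) * 4 powr g"
          using powr_powr[of 2 2 g] by (simp add: distrib_left powr_add mult.commute)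
        have "q ^ j = 2 powr ((g + s - real DIM('a)) * real j)"
          using q unfolding q_def by (simp only: powr_realpow[symmetric] powr_powr)
        also have "(g + s - real DIM('a)) * real j = g * j - real j * (real DIM('a) - s)"
          by (simp add: algebra_simps)
        also have "2 powr \<dots> = 2 powr (g * j) / (2 ^ j) powr (real DIM('a) - s)"
          by (simp add: powr_diff powr_powr[symmetric] powr_realpow)
        finally have 2: "q ^ j = 2 powr (g * j) / (2 ^ j) powr (real DIM('a) - s)" .
        have 3: "t powr s * t powr (real DIM('a) - s) = t ^ DIM('a)"
          using t by (simp add: powr_add[symmetric] powr_realpow)
        have 4: "(t / 2 ^ j) powr (real DIM('a) - s) = t powr (real DIM('a) - s) / (2 ^ j) powr (real DIM('a) - s)"
          using t by (simp add: powr_divide)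
        show ?thesis unfolding 1 2 4 3[symmetric] by simp
      qed
      finally show ?thesis .
    qed
    have "(\<integral>\<^sup>+x. ennreal ((1 + t / infdist x E) powr g) * indicator (ball y t) x \<partial>lborel)
      \<le> (\<integral>\<^sup>+x. ennreal (2 powr g) * indicator (ball y t) x + (\<Sum>j. ennreal (2 powr (g * (real j + 2))) * indicator (A j) x) \<partial>lborel)"
      by (intro nn_integral_mono pw)
    also have "\<dots> = ennreal (2 powr g) * emeasure lborel (ball y t) + (\<Sum>j. ennreal (2 powr (g * (real j + 2))) * emeasure lborel (A j))"
    proof -
      have fm: "(\<lambda>x. ennreal (2 powr (g * (real j + 2))) * indicator (A j) x) \<in> borel_measurable lborel" for j
        by (intro borel_measurable_times_ennreal borel_measurable_const borel_measurable_indicator) (simp add: A_meas)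
      have ball_int: "(\<integral>\<^sup>+x. ennreal (2 powr g) * indicator (ball y t) x \<partial>lborel) = ennreal (2 powr g) * emeasure lborel (ball y t)"
        by (rule nn_integral_cmult_indicator) simp
      have "(\<integral>\<^sup>+x. (\<Sum>j. ennreal (2 powr (g * (real j + 2))) * indicator (A j) x) \<partial>lborel)
          = (\<Sum>j. \<integral>\<^sup>+x. ennreal (2 powr (g * (real j + 2))) * indicator (A j) x \<partial>lborel)"
        by (rule nn_integral_suminf) (rule fm)
      also have "\<dots> = (\<Sum>j. ennreal (2 powr (g * (real j + 2))) * emeasure lborel (A j))"
        by (rule suminf_cong, rule nn_integral_cmult_indicator) (simp only: sets_lborel A_meas)
      finally have sum_int: "(\<integral>\<^sup>+x. (\<Sum>j. ennreal (2 powr (g * (real j + 2))) * indicator (A j) x) \<partial>lborel)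
        = (\<Sum>j. ennreal (2 powr (g * (real j + 2))) * emeasure lborel (A j))" .
      have bm: "(\<lambda>x. ennreal (2 powr g) * indicator (ball y t) x) \<in> borel_measurable lborel"
        by (intro borel_measurable_times_ennreal borel_measurable_const borel_measurable_indicator) simp
      have sm: "(\<lambda>x. \<Sum>j. ennreal (2 powr (g * (real j + 2))) * indicator (A j) x) \<in> borel_measurable lborel"
        by (rule borel_measurable_suminf_order) (rule fm)
      show ?thesis
        unfolding nn_integral_add[OF bm sm] ball_int sum_int ..
    qed
    also have "\<dots> \<le> ennreal (2 powr g * (v * t ^ DIM('a))) + (\<Sum>j. ennreal (4 powr g * C * t ^ DIM('a) * q ^ j))"
      using t v by (intro add_mono suminf_le term_j) (auto simp: emeasure_ball v_def ennreal_mult)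
    also have "(\<Sum>j. ennreal (4 powr g * C * t ^ DIM('a) * q ^ j)) = ennreal (4 powr g * C * t ^ DIM('a) * (1 / (1 - q)))"
      using q s t by (intro suminf_ennreal_eq sums_mult geometric_sums) auto
    also have "ennreal (2 powr g * (v * t ^ DIM('a))) + \<dots> = ennreal (K * t ^ DIM('a))"
      unfolding K_def using q s t v by (subst ennreal_plus[symmetric]) (auto simp: algebra_simps)
    finally show ?thesis .
  qed
  ultimately show ?thesis by (rule that)
qed

section \<open>Integrals of powers and power means\<close>

lemma nn_integral_powr_Ioc:
  fixes e T :: real
  assumes "e > -1" "T > 0"
  shows "(\<integral>\<^sup>+t. ennreal (t powr e) * indicator {0<..T} t \<partial>lborel) = ennreal (T powr (e + 1) / (e + 1))"
proof -
  have "(\<integral>\<^sup>+t. ennreal (t powr e) * indicator {0<..T} t \<partial>lborel)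
      = (\<integral>\<^sup>+t. ennreal (t powr e) * indicator {0..T} t \<partial>lborel)"
    by (intro nn_integral_cong) (auto simp: indicator_def)
  also have "\<dots> = ennreal (T powr (e + 1) / (e + 1))"
    using assms by (intro nn_integral_has_integral_lebesgue' has_integral_powr_from_0) auto
  finally show ?thesis .
qed

lemma nn_integral_powr_Ioi:
  fixes e T :: real
  assumes "e < -1" "T > 0"
  shows "(\<integral>\<^sup>+t. ennreal (t powr e) * indicator {T<..} t \<partial>lborel) \<le> ennreal (T powr (e + 1) / (- e - 1))"
proof -
  have "(\<integral>\<^sup>+t. ennreal (t powr e) * indicator {T<..} t \<partial>lborel)
      \<le> (\<integral>\<^sup>+t. ennreal (t powr e) * indicator {T..} t \<partial>lborel)"
    by (intro nn_integral_mono) (auto simp: indicator_def)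
  also have "\<dots> = ennreal (- (T powr (e + 1)) / (e + 1))"
    using assms by (intro nn_integral_has_integral_lebesgue' has_integral_powr_to_inf) auto
  also have "- (T powr (e + 1)) / (e + 1) = T powr (e + 1) / (- e - 1)"
    using assms by (simp add: field_simps)
  finally show ?thesis .
qed

lemma measurable_indicator_ball [measurable]:
  fixes f h :: "'b \<Rightarrow> 'a::euclidean_space"
  assumes [measurable]: "f \<in> borel_measurable M" "g \<in> borel_measurable M" "h \<in> borel_measurable M"
  shows "(\<lambda>z. indicator (ball (f z) (g z)) (h z) :: ennreal) \<in> borel_measurable M"
proof -
  have "(\<lambda>z. indicator (ball (f z) (g z)) (h z) :: ennreal) = (\<lambda>z. if dist (f z) (h z) < g z then 1 else 0)"
    by (auto simp: indicator_def)
  then show ?thesis by simp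
qed

text \<open>Jensen's inequality up to a factor 2, from \<open>k \<le> c + c^(1-q) k^q\<close> with the \<open>c\<close> that balances both terms.\<close>

lemma nn_integral_le_power_mean:
  fixes k :: "'a \<Rightarrow> real"
  assumes [measurable]: "k \<in> borel_measurable M" "B \<in> sets M"
    and k: "\<And>y. 0 \<le> k y" and q: "1 < q" and V: "0 < V" "emeasure M B \<le> ennreal V"
    and J: "0 \<le> J" "(\<integral>\<^sup>+y. ennreal (k y powr q) * indicator B y \<partial>M) \<le> ennreal J"
  shows "(\<integral>\<^sup>+y. ennreal (k y) * indicator B y \<partial>M) \<le> ennreal (2 * V powr (1 - 1/q) * J powr (1/q))"
proof (cases "J = 0")
  case True
  then have "AE y in M. ennreal (k y powr q) * indicator B y = 0"
    using J by (subst nn_integral_0_iff_AE[symmetric]) auto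
  then have "AE y in M. ennreal (k y) * indicator B y = 0"
    by eventually_elim (auto simp: indicator_def split: if_splits)
  then have "(\<integral>\<^sup>+y. ennreal (k y) * indicator B y \<partial>M) = 0"
    by (subst nn_integral_0_iff_AE) auto
  then show ?thesis by simp
next
  case False
  then have J0: "J > 0" using J by simp
  define c where "c = (J / V) powr (1/q)"
  have c: "c > 0" unfolding c_def using J0 V by simp
  have pw: "k y \<le> c + c powr (1 - q) * k y powr q" for y
  proof (cases "k y \<le> c")
    case False
    then have ky: "0 < c" "c < k y" using c by auto
    have "k y = k y powr (1 - q) * k y powr q" using ky by (simp add: powr_add[symmetric])
    also have "\<dots> \<le> c powr (1 - q) * k y powr q"
      using ky q by (intro mult_right_mono powr_mono2') auto
    finally show ?thesis using c by simp
  next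
    case True
    then show ?thesis by (meson add_increasing2 mult_nonneg_nonneg powr_ge_zero)
  qed
  have "(\<integral>\<^sup>+y. ennreal (k y) * indicator B y \<partial>M)
      \<le> (\<integral>\<^sup>+y. ennreal c * indicator B y + ennreal (c powr (1 - q)) * (ennreal (k y powr q) * indicator B y) \<partial>M)"
    using pw c by (intro nn_integral_mono)
      (auto simp: indicator_def ennreal_mult'[symmetric] ennreal_plus[symmetric] simp del: ennreal_plus intro!: ennreal_leI)
  also have "\<dots> = ennreal c * emeasure M B + ennreal (c powr (1 - q)) * (\<integral>\<^sup>+y. ennreal (k y powr q) * indicator B y \<partial>M)"
    by (simp add: nn_integral_add nn_integral_cmult)
  also have "\<dots> \<le> ennreal c * ennreal V + ennreal (c powr (1 - q)) * ennreal J"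
    by (intro add_mono mult_left_mono V J) auto
  also have "\<dots> = ennreal (c * V + c powr (1 - q) * J)"
    using c V J0 by (simp add: ennreal_mult'[symmetric] ennreal_plus[symmetric] del: ennreal_plus)
  also have "c * V + c powr (1 - q) * J = 2 * V powr (1 - 1/q) * J powr (1/q)"
  proof -
    have 1: "c * V = V powr (1 - 1/q) * J powr (1/q)"
      unfolding c_def using V J0 by (simp add: powr_divide powr_diff)
    have "c powr (1 - q) = (J / V) powr (1/q - 1)"
      unfolding c_def using q by (simp add: powr_powr field_simps)
    then have 2: "c powr (1 - q) * J = V powr (1 - 1/q) * J powr (1/q)"
      using V J0 by (simp add: powr_divide powr_diff)
    show ?thesis unfolding 1 2 by simp
  qed
  finally show ?thesis .
qed

section \<open>Weighted averages at a single scale\<close>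

text \<open>Up to the volume of the unit ball, the mean of \<open>h\<close> over \<open>B(x,t)\<close>, multiplied by the weight that the
comparison of distances at scale \<open>t\<close> produces. It is real-valued, so that real powers of it make sense;
\<open>local_integral_finite\<close> ensures that the conversion loses nothing.\<close>

definition avg_weighted :: "('a::euclidean_space \<Rightarrow> real) \<Rightarrow> real \<Rightarrow> ('a \<Rightarrow> real) \<Rightarrow> 'a \<Rightarrow> real \<Rightarrow> real" where
  "avg_weighted \<rho> b h x t = (1 + t / \<rho> x) powr b * t powr (- real DIM('a)) *
     enn2real (\<integral>\<^sup>+y. ennreal (h y) * indicator (ball x t) y \<partial>lborel)"

lemma avg_weighted_nonneg [simp]: "0 \<le> avg_weighted \<rho> b h x t"
  unfolding avg_weighted_def by simp

lemma measurable_avg_weighted [measurable]: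
  assumes [measurable]: "h \<in> borel_measurable borel" "\<rho> \<in> borel_measurable borel"
   "f \<in> borel_measurable M" "g \<in> borel_measurable M"
  shows "(\<lambda>z. avg_weighted \<rho> b h (f z) (g z)) \<in> borel_measurable M"
  unfolding avg_weighted_def by measurable

lemma local_integral_finite:
  fixes h :: "'a::euclidean_space \<Rightarrow> real"
  assumes [measurable]: "h \<in> borel_measurable borel" and h: "\<And>y. 0 \<le> h y" and r: "1 < r"
    and H: "(\<integral>\<^sup>+y. ennreal (h y powr r) \<partial>lborel) \<le> 1" and t: "0 < t"
  shows "(\<integral>\<^sup>+y. ennreal (h y) * indicator (ball x t) y \<partial>lborel) < \<infinity>"
proof -
  have "(\<integral>\<^sup>+y. ennreal (h y) * indicator (ball x t) y \<partial>lborel)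
    \<le> ennreal (2 * (unit_ball_vol (real DIM('a)) * t ^ DIM('a)) powr (1 - 1/r) * 1 powr (1/r))"
  proof (rule nn_integral_le_power_mean)
    have "(\<integral>\<^sup>+y. ennreal (h y powr r) * indicator (ball x t) y \<partial>lborel) \<le> (\<integral>\<^sup>+y. ennreal (h y powr r) \<partial>lborel)"
      by (intro nn_integral_mono) (auto simp: indicator_def)
    with H show "(\<integral>\<^sup>+y. ennreal (h y powr r) * indicator (ball x t) y \<partial>lborel) \<le> ennreal 1" by simp
  qed (use h r t in \<open>auto simp: emeasure_ball unit_ball_vol_pos\<close>)
  then show ?thesis by (simp add: order.strict_trans1)
qed

lemma powr_add_le:
  fixes a b q :: real
  assumes "0 \<le> a" "0 \<le> b" "0 \<le> q"
  shows "(a + b) powr q \<le> 2 powr q * (a powr q + b powr q)"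
proof -
  have "(a + b) powr q \<le> (2 * max a b) powr q" using assms by (intro powr_mono2) auto
  also have "\<dots> = 2 powr q * max a b powr q" using assms by (simp add: powr_mult)
  also have "\<dots> \<le> 2 powr q * (a powr q + b powr q)"
    by (intro mult_left_mono) (auto simp: max_def)
  finally show ?thesis .
qed

text \<open>At scale \<open>t\<close> split \<open>h\<close> at the height \<open>t^(-n/r)\<close>. The part above this height has small integral, so the
crude bound of its averages by this integral can be applied to \<open>\<sigma> - 1\<close> of the \<open>\<sigma>\<close> factors; to the
part below, Jensen's inequality applies. In both cases the weight is then integrated over a ball of radius \<open>t\<close>
by Tonelli's theorem. What remains is, for each \<open>y\<close>, an integral of a power of \<open>t\<close> over all scales beyond, respectively up
to, \<open>h(y)^(-r/n)\<close>; by the scaling relation it is a multiple of \<open>h(y)^r\<close>. Because \<open>r > 1\<close> and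
\<open>\<beta> > 0\<close>, both integrals converge.\<close>

lemma scale_estimate:
  fixes \<rho> :: "'a::euclidean_space \<Rightarrow> real" and b r \<beta> \<sigma> K :: real
  defines "n \<equiv> real DIM('a)"
  assumes [measurable]: "\<rho> \<in> borel_measurable borel" and \<rho>: "\<And>x. 0 \<le> \<rho> x"
    and r: "1 < r" and \<beta>: "0 < \<beta>" and \<sigma>: "1 < \<sigma>" and scal: "1/\<sigma> = 1/r - \<beta>/n"
    and K: "0 < K" "\<And>y t. 0 < t \<Longrightarrow>
      (\<integral>\<^sup>+x. ennreal ((1 + t / \<rho> x) powr (b * \<sigma>)) * indicator (ball y t) x \<partial>lborel) \<le> ennreal (K * t powr n)"
  shows "\<exists>C>0. \<forall>h \<in> borel_measurable borel. (\<forall>y. 0 \<le> h y) \<longrightarrow> (\<integral>\<^sup>+y. ennreal (h y powr r) \<partial>lborel) \<le> 1 \<longrightarrow>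
     (\<integral>\<^sup>+x. \<integral>\<^sup>+t. ennreal ((t powr \<beta> * avg_weighted \<rho> b h x t) powr \<sigma> / t) * indicator {0<..} t \<partial>lborel \<partial>lborel) \<le> ennreal C"
proof -
  define v where "v = unit_ball_vol (real DIM('a))"
  have v: "v > 0" unfolding v_def by (simp add: unit_ball_vol_pos)
  have n: "n > 0" unfolding n_def by simp
  \<comment> \<open>the exponent of \<open>t\<close> in the part above the truncation height\<close>
  define \<kappa> where "\<kappa> = - n * (1 - 1/r)"
  have \<kappa>: "\<kappa> < 0" unfolding \<kappa>_def using n r by (simp add: field_simps)
  define C1 where "C1 = 2 powr \<sigma> * K"
  define C2 where "C2 = 2 powr \<sigma> * K * (2 powr \<sigma> * v powr (\<sigma> - 1))"
  have C12: "C1 > 0" "C2 > 0" unfolding C1_def C2_def using K v by auto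
  define C where "C = C1 / (- \<kappa>) + C2 / (\<beta> * \<sigma>)"
  have "C > 0" unfolding C_def using C12 \<kappa> \<beta> \<sigma> by (intro add_pos_pos divide_pos_pos) auto
  moreover have "(\<integral>\<^sup>+x. \<integral>\<^sup>+t. ennreal ((t powr \<beta> * avg_weighted \<rho> b h x t) powr \<sigma> / t) * indicator {0<..} t \<partial>lborel \<partial>lborel) \<le> ennreal C"
    if hm[measurable]: "h \<in> borel_measurable borel" and h: "\<forall>y. 0 \<le> h y"
      and H: "(\<integral>\<^sup>+y. ennreal (h y powr r) \<partial>lborel) \<le> 1" for h :: "'a \<Rightarrow> real"
  proof -
    define lev where "lev t = t powr (- n / r)" for t :: real
    have lev_m[measurable]: "lev \<in> borel_measurable borel" unfolding lev_def by measurable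
    define hb where "hb t y = (if h y > lev t then h y else 0)" for t y
    define hs where "hs t y = (if h y > lev t then 0 else h y)" for t y
    have hbs: "0 \<le> hb t y" "0 \<le> hs t y" "h y = hb t y + hs t y" for t y
      unfolding hb_def hs_def using h by auto
    have hbm[measurable]: "(\<lambda>z. hb (f z) (g z)) \<in> borel_measurable M" "(\<lambda>z. hs (f z) (g z)) \<in> borel_measurable M"
      if [measurable]: "f \<in> borel_measurable M" "g \<in> borel_measurable M"
      for M :: "'z measure" and f g
      unfolding hb_def hs_def by measurable
    define W where "W t x = ennreal ((1 + t / \<rho> x) powr (b * \<sigma>))" for t x
    have Wm[measurable]: "(\<lambda>z. W (f z) (g z)) \<in> borel_measurable M"
      if [measurable]: "f \<in> borel_measurable M" "g \<in> borel_measurable M" for M :: "'z measure" and f g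
      unfolding W_def by measurable
    \<comment> \<open>Tonelli against the weight: integrating over balls of radius \<open>t\<close> costs a factor \<open>K t^n\<close>\<close>
    have ton: "(\<integral>\<^sup>+x. W t x * (\<integral>\<^sup>+y. k y * indicator (ball x t) y \<partial>lborel) \<partial>lborel)
        \<le> ennreal (K * t powr n) * (\<integral>\<^sup>+y. k y \<partial>lborel)"
      if t: "0 < t" and [measurable]: "k \<in> borel_measurable borel" for t and k :: "'a \<Rightarrow> ennreal"
    proof -
      have "(\<integral>\<^sup>+x. W t x * (\<integral>\<^sup>+y. k y * indicator (ball x t) y \<partial>lborel) \<partial>lborel)
          = (\<integral>\<^sup>+x. (\<integral>\<^sup>+y. W t x * (k y * indicator (ball x t) y) \<partial>lborel) \<partial>lborel)"
        by (intro nn_integral_cong) (simp add: nn_integral_cmult)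
      also have "\<dots> = (\<integral>\<^sup>+y. (\<integral>\<^sup>+x. W t x * (k y * indicator (ball x t) y) \<partial>lborel) \<partial>lborel)"
        by (rule lborel_pair.Fubini') measurable
      also have "\<dots> = (\<integral>\<^sup>+y. k y * (\<integral>\<^sup>+x. W t x * indicator (ball y t) x \<partial>lborel) \<partial>lborel)"
      proof (intro nn_integral_cong)
        fix y
        have "(\<integral>\<^sup>+x. W t x * (k y * indicator (ball x t) y) \<partial>lborel) = (\<integral>\<^sup>+x. k y * (W t x * indicator (ball y t) x) \<partial>lborel)"
          by (intro nn_integral_cong) (auto simp: indicator_def dist_commute mult_ac)
        then show "(\<integral>\<^sup>+x. W t x * (k y * indicator (ball x t) y) \<partial>lborel) = k y * (\<integral>\<^sup>+x. W t x * indicator (ball y t) x \<partial>lborel)"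
          by (simp add: nn_integral_cmult)
      qed
      also have "\<dots> \<le> (\<integral>\<^sup>+y. k y * ennreal (K * t powr n) \<partial>lborel)"
        unfolding W_def by (intro nn_integral_mono mult_left_mono K t) auto
      also have "\<dots> = ennreal (K * t powr n) * (\<integral>\<^sup>+y. k y \<partial>lborel)"
        by (simp add: nn_integral_multc mult.commute)
      finally show ?thesis .
    qed
    have at_scale: "(\<integral>\<^sup>+x. ennreal ((t powr \<beta> * avg_weighted \<rho> b h x t) powr \<sigma> / t) \<partial>lborel)
      \<le> ennreal (C1 * t powr (\<kappa> - 1)) * (\<integral>\<^sup>+y. ennreal (hb t y) \<partial>lborel)
       + ennreal (C2 * t powr (\<beta> * \<sigma> - 1)) * (\<integral>\<^sup>+y. ennreal (hs t y powr \<sigma>) \<partial>lborel)"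
      if t: "0 < t" for t
    proof -
      define ib where "ib x = (\<integral>\<^sup>+y. ennreal (hb t y) * indicator (ball x t) y \<partial>lborel)" for x
      define Js where "Js x = (\<integral>\<^sup>+y. ennreal (hs t y powr \<sigma>) * indicator (ball x t) y \<partial>lborel)" for x
      have lev0: "lev t > 0" unfolding lev_def using t by simp
      define L where "L = lev t powr (1 - r)"
      have hb_tot: "(\<integral>\<^sup>+y. ennreal (hb t y) \<partial>lborel) \<le> ennreal L"
      proof -
        have pw: "hb t y \<le> L * h y powr r" for y
        proof (cases "h y > lev t")
          case True
          then have "h y = h y powr (1 - r) * h y powr r" using lev0 by (simp add: powr_add[symmetric])
          also have "\<dots> \<le> L * h y powr r"
            unfolding L_def using lev0 True r by (intro mult_right_mono powr_mono2') auto
          finally show ?thesis unfolding hb_def using True by simp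
        qed (auto simp: hb_def L_def)
        have "(\<integral>\<^sup>+y. ennreal (hb t y) \<partial>lborel) \<le> (\<integral>\<^sup>+y. ennreal L * ennreal (h y powr r) \<partial>lborel)"
          unfolding L_def using pw[unfolded L_def]
          by (intro nn_integral_mono) (simp add: ennreal_mult'[symmetric] ennreal_leI)
        also have "\<dots> = ennreal L * (\<integral>\<^sup>+y. ennreal (h y powr r) \<partial>lborel)"
          by (simp add: nn_integral_cmult)
        also have "\<dots> \<le> ennreal L * 1" by (intro mult_left_mono H) auto
        finally show ?thesis by simp
      qed
      define P where "P = 2 powr \<sigma> * t powr (\<beta> * \<sigma> - 1 - n * \<sigma>)"
      have P0: "P > 0" unfolding P_def using t by simp
      define Q where "Q = 2 powr \<sigma> * (v * t powr n) powr (\<sigma> - 1)"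
      have Q0: "Q > 0" unfolding Q_def using t v by simp
      have pw: "ennreal ((t powr \<beta> * avg_weighted \<rho> b h x t) powr \<sigma> / t)
          \<le> W t x * (ennreal (P * L powr (\<sigma> - 1)) * ib x + ennreal (P * Q) * Js x)" for x
      proof -
        have "ib x \<le> (\<integral>\<^sup>+y. ennreal (hb t y) \<partial>lborel)"
          unfolding ib_def by (intro nn_integral_mono) (auto simp: indicator_def)
        with hb_tot have ibL: "ib x \<le> ennreal L" by (rule order_trans[rotated])
        then obtain i1 where i1: "ib x = ennreal i1" "0 \<le> i1" "i1 \<le> L"
          by (cases "ib x") (auto simp: L_def top_unique)
        have volB: "emeasure lborel (ball x t) \<le> ennreal (v * t powr n)"
          using t v by (simp add: emeasure_ball v_def n_def powr_realpow)
        have "Js x \<le> (\<integral>\<^sup>+y. ennreal (lev t powr \<sigma>) * indicator (ball x t) y \<partial>lborel)"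
          unfolding Js_def
        proof (intro nn_integral_mono mult_right_mono ennreal_leI)
          fix y show "hs t y powr \<sigma> \<le> lev t powr \<sigma>"
            unfolding hs_def using h lev0 \<sigma> by (auto intro!: powr_mono2)
        qed auto
        also have "\<dots> = ennreal (lev t powr \<sigma>) * emeasure lborel (ball x t)"
          by (simp add: nn_integral_cmult_indicator)
        also have "\<dots> < \<infinity>"
          using order.strict_trans1[OF volB ennreal_less_top] by (simp add: ennreal_mult_less_top)
        finally obtain J where J: "Js x = ennreal J" "0 \<le> J" by (cases "Js x") auto
        have "(\<integral>\<^sup>+y. ennreal (hs t y) * indicator (ball x t) y \<partial>lborel)
           \<le> ennreal (2 * (v * t powr n) powr (1 - 1/\<sigma>) * J powr (1/\<sigma>))"
          using J volB \<sigma> t v hbs(2) unfolding Js_def by (intro nn_integral_le_power_mean) auto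
        then obtain i2 where i2: "(\<integral>\<^sup>+y. ennreal (hs t y) * indicator (ball x t) y \<partial>lborel) = ennreal i2"
          "0 \<le> i2" "i2 \<le> 2 * (v * t powr n) powr (1 - 1/\<sigma>) * J powr (1/\<sigma>)"
          by (cases "\<integral>\<^sup>+y. ennreal (hs t y) * indicator (ball x t) y \<partial>lborel") (auto simp: top_unique)
        have "(\<integral>\<^sup>+y. ennreal (h y) * indicator (ball x t) y \<partial>lborel) 
           = (\<integral>\<^sup>+y. ennreal (hb t y) * indicator (ball x t) y + ennreal (hs t y) * indicator (ball x t) y \<partial>lborel)"
          by (intro nn_integral_cong) (simp add: hbs(3)[of _ t] hbs(1,2) ennreal_plus distrib_right)
        also have "\<dots> = ennreal (i1 + i2)"
          using i1 i2 unfolding ib_def by (simp add: nn_integral_add)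
        finally have i12: "enn2real (\<integral>\<^sup>+y. ennreal (h y) * indicator (ball x t) y \<partial>lborel) = i1 + i2"
          using i1 i2 by (simp del: ennreal_plus)
        have e1: "i1 powr \<sigma> \<le> L powr (\<sigma> - 1) * i1"
        proof (cases "i1 = 0")
          case False
          then have "i1 powr \<sigma> = i1 powr (\<sigma> - 1) * i1" using i1 by (simp add: powr_diff)
          also have "\<dots> \<le> L powr (\<sigma> - 1) * i1" using i1 \<sigma> by (intro mult_right_mono powr_mono2) auto
          finally show ?thesis .
        qed simp
        have "i2 powr \<sigma> \<le> (2 * (v * t powr n) powr (1 - 1/\<sigma>) * J powr (1/\<sigma>)) powr \<sigma>"
          using i2 \<sigma> by (intro powr_mono2) auto
        also have "\<dots> = Q * J"
        proof -
          have "(1 - 1/\<sigma>) * \<sigma> = \<sigma> - 1" "1/\<sigma> * \<sigma> = 1" using \<sigma> by (auto simp: field_simps)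
          moreover have "(2 * (v * t powr n) powr (1 - 1/\<sigma>) * J powr (1/\<sigma>)) powr \<sigma>
             = 2 powr \<sigma> * (v * t powr n) powr ((1 - 1/\<sigma>) * \<sigma>) * J powr (1/\<sigma> * \<sigma>)"
            using v J by (simp only: powr_mult[of _ _ \<sigma>] powr_powr)
          ultimately show ?thesis unfolding Q_def using J by simp
        qed
        finally have e2: "i2 powr \<sigma> \<le> Q * J" .
        have "(t powr \<beta> * avg_weighted \<rho> b h x t) powr \<sigma> / t
           = (t powr \<beta> * ((1 + t / \<rho> x) powr b * t powr (- n) * (i1 + i2))) powr \<sigma> * t powr (- 1)"
          unfolding avg_weighted_def i12 n_def[symmetric] using t by (simp add: powr_minus divide_inverse)
        also have "\<dots> = (1 + t / \<rho> x) powr (b * \<sigma>) * ((t powr (\<beta> * \<sigma>) * t powr (- n * \<sigma>) * t powr (- 1)) * (i1 + i2) powr \<sigma>)"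
          by (simp only: powr_mult powr_powr) (simp only: mult_ac)
        also have "t powr (\<beta> * \<sigma>) * t powr (- n * \<sigma>) * t powr (- 1) = t powr (\<beta> * \<sigma> - 1 - n * \<sigma>)"
          by (simp only: powr_add[symmetric]) (simp add: algebra_simps)
        finally have "(t powr \<beta> * avg_weighted \<rho> b h x t) powr \<sigma> / t
           = (1 + t / \<rho> x) powr (b * \<sigma>) * (t powr (\<beta> * \<sigma> - 1 - n * \<sigma>) * (i1 + i2) powr \<sigma>)" .
        also have "\<dots> \<le> (1 + t / \<rho> x) powr (b * \<sigma>) * (t powr (\<beta> * \<sigma> - 1 - n * \<sigma>) * (2 powr \<sigma> * (L powr (\<sigma> - 1) * i1 + Q * J)))"
        proof (intro mult_left_mono)
          have "(i1 + i2) powr \<sigma> \<le> 2 powr \<sigma> * (i1 powr \<sigma> + i2 powr \<sigma>)"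
            using i1 i2 \<sigma> by (intro powr_add_le) auto
          also have "\<dots> \<le> 2 powr \<sigma> * (L powr (\<sigma> - 1) * i1 + Q * J)"
            using e1 e2 by (intro mult_left_mono add_mono) auto
          finally show "(i1 + i2) powr \<sigma> \<le> 2 powr \<sigma> * (L powr (\<sigma> - 1) * i1 + Q * J)" .
        qed auto
        also have "\<dots> = (1 + t / \<rho> x) powr (b * \<sigma>) * (P * L powr (\<sigma> - 1) * i1 + P * Q * J)"
          unfolding P_def by (simp add: algebra_simps)
        finally have "ennreal ((t powr \<beta> * avg_weighted \<rho> b h x t) powr \<sigma> / t) \<le>
           ennreal ((1 + t / \<rho> x) powr (b * \<sigma>) * (P * L powr (\<sigma> - 1) * i1 + P * Q * J))" by (rule ennreal_leI)
        also have "\<dots> = W t x * (ennreal (P * L powr (\<sigma> - 1)) * ib x + ennreal (P * Q) * Js x)"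
          unfolding W_def i1(1) J(1) using i1 J P0 Q0
          by (simp add: ennreal_mult'[symmetric] ennreal_plus[symmetric] del: ennreal_plus)
        finally show ?thesis .
      qed
      have [measurable]: "ib \<in> borel_measurable borel" "Js \<in> borel_measurable borel"
        unfolding ib_def Js_def by measurable
      have "(\<integral>\<^sup>+x. ennreal ((t powr \<beta> * avg_weighted \<rho> b h x t) powr \<sigma> / t) \<partial>lborel)
         \<le> (\<integral>\<^sup>+x. W t x * (ennreal (P * L powr (\<sigma> - 1)) * ib x + ennreal (P * Q) * Js x) \<partial>lborel)"
        by (intro nn_integral_mono pw)
      also have "\<dots> = (\<integral>\<^sup>+x. ennreal (P * L powr (\<sigma> - 1)) * (W t x * ib x) + ennreal (P * Q) * (W t x * Js x) \<partial>lborel)"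
        by (intro nn_integral_cong) (simp add: algebra_simps)
      also have "\<dots> = ennreal (P * L powr (\<sigma> - 1)) * (\<integral>\<^sup>+x. W t x * ib x \<partial>lborel) + ennreal (P * Q) * (\<integral>\<^sup>+x. W t x * Js x \<partial>lborel)"
        by (simp add: nn_integral_add nn_integral_cmult)
      also have "\<dots> \<le> ennreal (P * L powr (\<sigma> - 1)) * (ennreal (K * t powr n) * (\<integral>\<^sup>+y. ennreal (hb t y) \<partial>lborel))
          + ennreal (P * Q) * (ennreal (K * t powr n) * (\<integral>\<^sup>+y. ennreal (hs t y powr \<sigma>) \<partial>lborel))"
        unfolding ib_def Js_def by (intro add_mono mult_left_mono ton t) measurable
      also have "\<dots> = ennreal (P * L powr (\<sigma> - 1) * (K * t powr n)) * (\<integral>\<^sup>+y. ennreal (hb t y) \<partial>lborel)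
          + ennreal (P * Q * (K * t powr n)) * (\<integral>\<^sup>+y. ennreal (hs t y powr \<sigma>) \<partial>lborel)"
        using P0 Q0 K by (simp add: ennreal_mult' mult.assoc)
      also have "P * L powr (\<sigma> - 1) * (K * t powr n) = C1 * t powr (\<kappa> - 1)"
      proof -
        have ex: "\<beta> * \<sigma> - 1 - n * \<sigma> + (- n / r) * (1 - r) * (\<sigma> - 1) + n = \<kappa> - 1"
        proof -
          have "\<beta> = n / r - n / \<sigma>" using scal n by (simp add: field_simps)
          then show ?thesis unfolding \<kappa>_def using r \<sigma> by (simp add: field_simps)
        qed
        show ?thesis
          unfolding P_def L_def lev_def C1_def ex[symmetric] powr_add powr_powr by simp
      qed
      also have "P * Q * (K * t powr n) = C2 * t powr (\<beta> * \<sigma> - 1)"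
      proof -
        have ex: "\<beta> * \<sigma> - 1 = \<beta> * \<sigma> - 1 - n * \<sigma> + n * (\<sigma> - 1) + n" by (simp add: algebra_simps)
        have "Q = 2 powr \<sigma> * v powr (\<sigma> - 1) * t powr (n * (\<sigma> - 1))"
          unfolding Q_def using v t by (simp add: powr_mult powr_powr)
        then show ?thesis
          unfolding P_def C2_def by (subst (2) ex) (simp add: powr_add)
      qed
      finally show ?thesis .
    qed
    have big: "(\<integral>\<^sup>+t. ennreal (C1 * t powr (\<kappa> - 1)) * ennreal (hb t y) * indicator {0<..} t \<partial>lborel)
       \<le> ennreal (C1 / (- \<kappa>) * h y powr r)" for y
    proof (cases "h y = 0")
      case False
      then have c: "h y > 0" using h by (simp add: order_less_le)
      define T where "T = h y powr (- r / n)"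
      have T: "T > 0" unfolding T_def using c by simp
      have lev_T: "lev T = h y" unfolding T_def lev_def using c r n by (simp add: powr_powr)
      have "(\<integral>\<^sup>+t. ennreal (C1 * t powr (\<kappa> - 1)) * ennreal (hb t y) * indicator {0<..} t \<partial>lborel)
        \<le> (\<integral>\<^sup>+t. ennreal (C1 * h y) * (ennreal (t powr (\<kappa> - 1)) * indicator {T<..} t) \<partial>lborel)"
      proof (intro nn_integral_mono)
        fix t :: real
        show "ennreal (C1 * t powr (\<kappa> - 1)) * ennreal (hb t y) * indicator {0<..} t
            \<le> ennreal (C1 * h y) * (ennreal (t powr (\<kappa> - 1)) * indicator {T<..} t)"
        proof (cases "0 < t \<and> lev t < h y")
          case True
          have "T < t"
          proof (rule ccontr)
            assume "\<not> T < t"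
            then have "lev T \<le> lev t" unfolding lev_def using True n r by (intro powr_mono2') auto
            with lev_T True show False by simp
          qed
          then show ?thesis using True C12 c
            by (simp add: hb_def ennreal_mult'[symmetric] mult_ac)
        next
          case False
          then show ?thesis by (auto simp: hb_def indicator_def)
        qed
      qed
      also have "\<dots> = ennreal (C1 * h y) * (\<integral>\<^sup>+t. ennreal (t powr (\<kappa> - 1)) * indicator {T<..} t \<partial>lborel)"
        by (simp add: nn_integral_cmult)
      also have "\<dots> \<le> ennreal (C1 * h y) * ennreal (T powr (\<kappa> - 1 + 1) / (- (\<kappa> - 1) - 1))"
        using \<kappa> T by (intro mult_left_mono nn_integral_powr_Ioi) auto
      also have "\<dots> = ennreal (C1 * h y * (T powr \<kappa> / (- \<kappa>)))"
        using C12 c \<kappa> by (subst ennreal_mult'[symmetric]) (auto simp: field_simps)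
      also have "C1 * h y * (T powr \<kappa> / (- \<kappa>)) = C1 / (- \<kappa>) * h y powr r"
      proof -
        have "- r / n * \<kappa> = r - 1" unfolding \<kappa>_def using n r by (simp add: field_simps)
        then have "T powr \<kappa> = h y powr (r - 1)" unfolding T_def powr_powr by simp
        then show ?thesis using c by (simp add: powr_diff)
      qed
      finally show ?thesis .
    qed (simp add: hb_def if_distrib cong: if_cong)
    have small: "(\<integral>\<^sup>+t. ennreal (C2 * t powr (\<beta> * \<sigma> - 1)) * ennreal (hs t y powr \<sigma>) * indicator {0<..} t \<partial>lborel)
       \<le> ennreal (C2 / (\<beta> * \<sigma>) * h y powr r)" for y
    proof (cases "h y = 0")
      case False
      then have c: "h y > 0" using h by (simp add: order_less_le)
      define T where "T = h y powr (- r / n)"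
      have T: "T > 0" unfolding T_def using c by simp
      have lev_T: "lev T = h y" unfolding T_def lev_def using c r n by (simp add: powr_powr)
      have bs: "\<beta> * \<sigma> > 0" using \<beta> \<sigma> by simp
      have "(\<integral>\<^sup>+t. ennreal (C2 * t powr (\<beta> * \<sigma> - 1)) * ennreal (hs t y powr \<sigma>) * indicator {0<..} t \<partial>lborel)
        \<le> (\<integral>\<^sup>+t. ennreal (C2 * h y powr \<sigma>) * (ennreal (t powr (\<beta> * \<sigma> - 1)) * indicator {0<..T} t) \<partial>lborel)"
      proof (intro nn_integral_mono)
        fix t :: real
        show "ennreal (C2 * t powr (\<beta> * \<sigma> - 1)) * ennreal (hs t y powr \<sigma>) * indicator {0<..} t
            \<le> ennreal (C2 * h y powr \<sigma>) * (ennreal (t powr (\<beta> * \<sigma> - 1)) * indicator {0<..T} t)"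
        proof (cases "0 < t \<and> h y \<le> lev t")
          case True
          have "t \<le> T"
          proof (rule ccontr)
            assume "\<not> t \<le> T"
            then have "lev t < lev T" unfolding lev_def using T n r by (intro powr_less_mono2_neg) auto
            with lev_T True show False by simp
          qed
          then show ?thesis using True C12 c
            by (simp add: hs_def ennreal_mult'[symmetric] mult_ac)
        next
          case False
          then show ?thesis by (auto simp: hs_def indicator_def)
        qed
      qed
      also have "\<dots> = ennreal (C2 * h y powr \<sigma>) * (\<integral>\<^sup>+t. ennreal (t powr (\<beta> * \<sigma> - 1)) * indicator {0<..T} t \<partial>lborel)"
        by (simp add: nn_integral_cmult)
      also have "\<dots> = ennreal (C2 * h y powr \<sigma>) * ennreal (T powr (\<beta> * \<sigma> - 1 + 1) / (\<beta> * \<sigma> - 1 + 1))"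
        using bs T by (subst nn_integral_powr_Ioc) auto
      also have "\<dots> = ennreal (C2 * h y powr \<sigma> * (T powr (\<beta> * \<sigma>) / (\<beta> * \<sigma>)))"
        using C12 c bs by (subst ennreal_mult'[symmetric]) auto
      also have "C2 * h y powr \<sigma> * (T powr (\<beta> * \<sigma>) / (\<beta> * \<sigma>)) = C2 / (\<beta> * \<sigma>) * h y powr r"
      proof -
        have "\<beta> = n / r - n / \<sigma>" using scal n by (simp add: field_simps)
        then have "r = \<sigma> + - r / n * (\<beta> * \<sigma>)" using n r \<sigma> by (simp add: field_simps)
        moreover have "h y powr \<sigma> * T powr (\<beta> * \<sigma>) = h y powr (\<sigma> + - r / n * (\<beta> * \<sigma>))"
          unfolding T_def powr_powr powr_add ..
        ultimately have "h y powr \<sigma> * T powr (\<beta> * \<sigma>) = h y powr r" by metis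
        then show ?thesis by (simp add: field_simps)
      qed
      finally show ?thesis .
    qed (simp add: hs_def if_distrib cong: if_cong)
    have "(\<integral>\<^sup>+x. \<integral>\<^sup>+t. ennreal ((t powr \<beta> * avg_weighted \<rho> b h x t) powr \<sigma> / t) * indicator {0<..} t \<partial>lborel \<partial>lborel)
       = (\<integral>\<^sup>+t. \<integral>\<^sup>+x. ennreal ((t powr \<beta> * avg_weighted \<rho> b h x t) powr \<sigma> / t) * indicator {0<..} t \<partial>lborel \<partial>lborel)"
      by (rule lborel_pair.Fubini'[symmetric]) measurable
    also have "\<dots> = (\<integral>\<^sup>+t. (\<integral>\<^sup>+x. ennreal ((t powr \<beta> * avg_weighted \<rho> b h x t) powr \<sigma> / t) \<partial>lborel) * indicator {0<..} t \<partial>lborel)"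
      by (simp add: nn_integral_multc)
    also have "\<dots> \<le> (\<integral>\<^sup>+t. (ennreal (C1 * t powr (\<kappa> - 1)) * (\<integral>\<^sup>+y. ennreal (hb t y) \<partial>lborel)
       + ennreal (C2 * t powr (\<beta> * \<sigma> - 1)) * (\<integral>\<^sup>+y. ennreal (hs t y powr \<sigma>) \<partial>lborel)) * indicator {0<..} t \<partial>lborel)"
      by (intro nn_integral_mono) (auto simp: indicator_def intro!: at_scale)
    also have "\<dots> = (\<integral>\<^sup>+t. \<integral>\<^sup>+y. (ennreal (C1 * t powr (\<kappa> - 1)) * ennreal (hb t y) * indicator {0<..} t
       + ennreal (C2 * t powr (\<beta> * \<sigma> - 1)) * ennreal (hs t y powr \<sigma>) * indicator {0<..} t) \<partial>lborel \<partial>lborel)"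
      by (simp add: nn_integral_add nn_integral_cmult nn_integral_multc distrib_right)
    also have "\<dots> = (\<integral>\<^sup>+y. \<integral>\<^sup>+t. (ennreal (C1 * t powr (\<kappa> - 1)) * ennreal (hb t y) * indicator {0<..} t
       + ennreal (C2 * t powr (\<beta> * \<sigma> - 1)) * ennreal (hs t y powr \<sigma>) * indicator {0<..} t) \<partial>lborel \<partial>lborel)"
      by (rule lborel_pair.Fubini') measurable
    also have "\<dots> = (\<integral>\<^sup>+y. (\<integral>\<^sup>+t. ennreal (C1 * t powr (\<kappa> - 1)) * ennreal (hb t y) * indicator {0<..} t \<partial>lborel)
       + (\<integral>\<^sup>+t. ennreal (C2 * t powr (\<beta> * \<sigma> - 1)) * ennreal (hs t y powr \<sigma>) * indicator {0<..} t \<partial>lborel) \<partial>lborel)"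
      by (intro nn_integral_cong nn_integral_add) measurable
    also have "\<dots> \<le> (\<integral>\<^sup>+y. ennreal C * ennreal (h y powr r) \<partial>lborel)"
    proof (intro nn_integral_mono)
      fix y :: 'a
      have "(\<integral>\<^sup>+t. ennreal (C1 * t powr (\<kappa> - 1)) * ennreal (hb t y) * indicator {0<..} t \<partial>lborel)
         + (\<integral>\<^sup>+t. ennreal (C2 * t powr (\<beta> * \<sigma> - 1)) * ennreal (hs t y powr \<sigma>) * indicator {0<..} t \<partial>lborel)
        \<le> ennreal (C1 / (- \<kappa>) * h y powr r) + ennreal (C2 / (\<beta> * \<sigma>) * h y powr r)"
        by (intro add_mono big small)
      also have "\<dots> = ennreal (C1 / (- \<kappa>) * h y powr r + C2 / (\<beta> * \<sigma>) * h y powr r)"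
        using C12 \<kappa> \<beta> \<sigma> by (intro ennreal_plus[symmetric] mult_nonneg_nonneg divide_nonneg_nonneg) auto
      also have "\<dots> = ennreal C * ennreal (h y powr r)"
        unfolding C_def by (subst ennreal_mult''[symmetric]) (simp_all only: powr_ge_zero distrib_right)
      finally show "(\<integral>\<^sup>+t. ennreal (C1 * t powr (\<kappa> - 1)) * ennreal (hb t y) * indicator {0<..} t \<partial>lborel)
         + (\<integral>\<^sup>+t. ennreal (C2 * t powr (\<beta> * \<sigma> - 1)) * ennreal (hs t y powr \<sigma>) * indicator {0<..} t \<partial>lborel)
        \<le> ennreal C * ennreal (h y powr r)" .
    qed
    also have "\<dots> = ennreal C * (\<integral>\<^sup>+y. ennreal (h y powr r) \<partial>lborel)"
      by (simp add: nn_integral_cmult)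
    also have "\<dots> \<le> ennreal C * 1" by (intro mult_left_mono H) auto
    finally show ?thesis by simp
  qed
  ultimately show ?thesis by blast
qed

section \<open>Summation over all scales\<close>

text \<open>As \<open>t^n f(t)\<close> increases, each of the two integrals controls \<open>f\<close> pointwise, one by
\<open>\<phi>^(1/s1) t^(-1-\<epsilon>)\<close> and the other one by \<open>\<phi>^(1/s2) t^(-1+\<epsilon>)\<close>, with \<open>\<phi>\<close> the sum of the integrals. Using
the second bound up to \<open>\<phi>^(-1/n)\<close> and the first one beyond, the integral of \<open>f\<close> is at most a multiple of
\<open>\<phi>^(1/s)\<close>, and Young's inequality separates the factor \<open>g\<close>. The right-hand side is linear in the two
integrals, so this bound can be integrated in the space variable.\<close>

lemma scale_interpolation:
  fixes n \<epsilon> s s1 s2 :: real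
  assumes n: "0 < n" and \<epsilon>: "0 < \<epsilon>" "\<epsilon> < 1" and s: "1 < s" "1 < s1" "1 < s2"
    and s12: "1/s1 = 1/s - \<epsilon>/n" "1/s2 = 1/s + \<epsilon>/n"
  shows "\<exists>C>0. \<forall>f \<in> borel_measurable borel. \<forall>g\<ge>0. (\<forall>t>0. 0 \<le> f t) \<longrightarrow>
     (\<forall>t \<tau>. 0 < t \<longrightarrow> t \<le> \<tau> \<longrightarrow> t powr n * f t \<le> \<tau> powr n * f \<tau>) \<longrightarrow>
     ennreal g * (\<integral>\<^sup>+t. ennreal (f t) * indicator {0<..} t \<partial>lborel) \<le> ennreal (g powr (s / (s - 1))) +
       ennreal C * ((\<integral>\<^sup>+t. ennreal ((t powr (1 + \<epsilon>) * f t) powr s1 / t) * indicator {0<..} t \<partial>lborel) +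
         (\<integral>\<^sup>+t. ennreal ((t powr (1 - \<epsilon>) * f t) powr s2 / t) * indicator {0<..} t \<partial>lborel))"
proof -
  define A where "A = 2 powr (n + 2) / \<epsilon>"
  have A: "A > 0" unfolding A_def using \<epsilon> by simp
  define C where "C = A powr s"
  have C: "C > 0" unfolding C_def using A by simp
  moreover have "ennreal g * (\<integral>\<^sup>+t. ennreal (f t) * indicator {0<..} t \<partial>lborel) \<le> ennreal (g powr (s / (s - 1))) +
       ennreal C * ((\<integral>\<^sup>+t. ennreal ((t powr (1 + \<epsilon>) * f t) powr s1 / t) * indicator {0<..} t \<partial>lborel) +
         (\<integral>\<^sup>+t. ennreal ((t powr (1 - \<epsilon>) * f t) powr s2 / t) * indicator {0<..} t \<partial>lborel))"
     (is "_ \<le> _ + ennreal C * (?I1 + ?I2)")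
    if fm[measurable]: "f \<in> borel_measurable borel" and g: "g \<ge> 0" and f0: "\<forall>t>0. 0 \<le> f t"
      and mono: "\<forall>t \<tau>. 0 < t \<longrightarrow> t \<le> \<tau> \<longrightarrow> t powr n * f t \<le> \<tau> powr n * f \<tau>" for f g
  proof (cases "?I1 + ?I2 = \<infinity>")
    case True
    have "ennreal C * (?I1 + ?I2) = \<infinity>" unfolding True using C by (simp add: ennreal_mult_top)
    then show ?thesis by simp
  next
    case False
    then obtain \<phi> where \<phi>: "?I1 + ?I2 = ennreal \<phi>" "\<phi> \<ge> 0"
      by (cases "?I1 + ?I2") auto
    \<comment> \<open>monotonicity turns the integral bounds into pointwise bounds\<close>
    have ptw: "t powr e * f t \<le> 2 powr n * (2 * \<phi>) powr (1 / q)"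
      if q: "1 < q" and e: "0 < e" and t: "0 < t"
        and I: "(\<integral>\<^sup>+t. ennreal ((t powr e * f t) powr q / t) * indicator {0<..} t \<partial>lborel) \<le> ennreal \<phi>" for e q t
    proof -
      define k where "k = (t powr e * f t / 2 powr n) powr q / (2 * t)"
      have "ennreal (k * t) = (\<integral>\<^sup>+\<tau>. ennreal k * indicator {t..2*t} \<tau> \<partial>lborel)"
        using t by (simp add: nn_integral_cmult_indicator ennreal_mult''[symmetric])
      also have "\<dots> \<le> (\<integral>\<^sup>+t. ennreal ((t powr e * f t) powr q / t) * indicator {0<..} t \<partial>lborel)"
      proof (intro nn_integral_mono)
        fix \<tau> :: real
        show "ennreal k * indicator {t..2*t} \<tau> \<le> ennreal ((\<tau> powr e * f \<tau>) powr q / \<tau>) * indicator {0<..} \<tau>"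
        proof (cases "\<tau> \<in> {t..2*t}")
          case True
          then have \<tau>: "t \<le> \<tau>" "\<tau> \<le> 2 * t" "0 < \<tau>" using t by auto
          have "t powr n * f t \<le> \<tau> powr n * f \<tau>" using mono t \<tau> by blast
          also have "\<dots> \<le> (2 * t) powr n * f \<tau>"
            using \<tau> n f0 by (intro mult_right_mono powr_mono2) auto
          also have "\<dots> = t powr n * (2 powr n * f \<tau>)" by (simp add: powr_mult)
          finally have "f t \<le> 2 powr n * f \<tau>" using t by simp
          then have 1: "f t / 2 powr n \<le> f \<tau>" by (simp add: field_simps)
          have "t powr e * (f t / 2 powr n) \<le> \<tau> powr e * f \<tau>"
            using 1 \<tau> t e f0 by (intro mult_mono powr_mono2) auto
          then have "(t powr e * f t / 2 powr n) powr q / (2 * t) \<le> (\<tau> powr e * f \<tau>) powr q / \<tau>"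
            using q t \<tau> f0 by (intro frac_le powr_mono2) auto
          then show ?thesis unfolding k_def using True \<tau> by (simp add: ennreal_leI)
        qed simp
      qed
      also note I
      finally have "k * t \<le> \<phi>" using \<phi> by simp
      then have "(t powr e * f t / 2 powr n) powr q \<le> 2 * \<phi>" unfolding k_def using t by simp
      then have "((t powr e * f t / 2 powr n) powr q) powr (1/q) \<le> (2 * \<phi>) powr (1/q)"
        using q by (intro powr_mono2) auto
      moreover have "((t powr e * f t / 2 powr n) powr q) powr (1/q) = t powr e * f t / 2 powr n"
        using q t f0 by (simp add: powr_powr)
      ultimately have "t powr e * f t / 2 powr n \<le> (2 * \<phi>) powr (1/q)" by simp
      then show ?thesis by (simp add: pos_divide_le_eq mult.commute)
    qed
    have I12: "?I1 \<le> ennreal \<phi>" "?I2 \<le> ennreal \<phi>"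
      unfolding \<phi>(1)[symmetric] by (auto intro: add_increasing add_increasing2)
    have p1: "t powr (1 + \<epsilon>) * f t \<le> 2 powr n * (2 * \<phi>) powr (1 / s1)" if "0 < t" for t
      using that s \<epsilon> I12 by (intro ptw) auto
    have p2: "t powr (1 - \<epsilon>) * f t \<le> 2 powr n * (2 * \<phi>) powr (1 / s2)" if "0 < t" for t
      using that s \<epsilon> I12 by (intro ptw) auto
    have two: "(2 * \<phi>) powr (1 / q) \<le> 2 * \<phi> powr (1/q)" if "1 < q" for q
    proof -
      have "2 powr (1/q) \<le> 2 powr 1" using that by (intro powr_mono) auto
      then show ?thesis using \<phi> by (simp add: powr_mult mult_right_mono)
    qed
    have total: "(\<integral>\<^sup>+t. ennreal (f t) * indicator {0<..} t \<partial>lborel) \<le> ennreal (A * \<phi> powr (1/s))"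
    proof (cases "\<phi> = 0")
      case True
      have "f t = 0" if "0 < t" for t
      proof -
        have "t powr (1 + \<epsilon>) * f t \<le> 0" using p1[OF that] True by simp
        then show ?thesis using that f0 by (auto simp: mult_le_0_iff not_le intro: antisym)
      qed
      then have "(\<integral>\<^sup>+t. ennreal (f t) * indicator {0<..} t \<partial>lborel) = (\<integral>\<^sup>+t. 0 \<partial>(lborel :: real measure))"
        by (intro nn_integral_cong) (auto simp: indicator_def)
      then show ?thesis by simp
    next
      case False
      then have \<phi>0: "\<phi> > 0" using \<phi> by simp
      define B where "B = 2 powr (n + 1)"
      have B: "B > 0" unfolding B_def by simp
      \<comment> \<open>the scale at which the two pointwise bounds coincide\<close>
      define T where "T = \<phi> powr (- 1 / n)"
      have T: "T > 0" unfolding T_def using \<phi>0 by simp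
      have b1: "f t \<le> B * \<phi> powr (1/s1) * t powr (- 1 - \<epsilon>)" if t: "0 < t" for t
      proof -
        have "t powr (1 + \<epsilon>) * f t \<le> 2 powr n * (2 * \<phi> powr (1 / s1))"
          using p1[OF t] two[OF s(2)] by (meson mult_left_mono order_trans powr_ge_zero)
        also have "\<dots> = B * \<phi> powr (1/s1)" unfolding B_def by (simp add: powr_add)
        finally have "f t \<le> B * \<phi> powr (1/s1) / t powr (1 + \<epsilon>)" using t by (simp add: field_simps)
        also have "\<dots> = B * \<phi> powr (1/s1) * t powr (- (1 + \<epsilon>))" by (simp only: powr_minus divide_inverse)
        finally show ?thesis by simp
      qed
      have b2: "f t \<le> B * \<phi> powr (1/s2) * t powr (\<epsilon> - 1)" if t: "0 < t" for t
      proof -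
        have "t powr (1 - \<epsilon>) * f t \<le> 2 powr n * (2 * \<phi> powr (1 / s2))"
          using p2[OF t] two[OF s(3)] by (meson mult_left_mono order_trans powr_ge_zero)
        also have "\<dots> = B * \<phi> powr (1/s2)" unfolding B_def by (simp add: powr_add)
        finally have "f t \<le> B * \<phi> powr (1/s2) / t powr (1 - \<epsilon>)" using t by (simp add: field_simps)
        also have "\<dots> = B * \<phi> powr (1/s2) * t powr (- (1 - \<epsilon>))" by (simp only: powr_minus divide_inverse)
        finally show ?thesis by simp
      qed
      have "(\<integral>\<^sup>+t. ennreal (f t) * indicator {0<..} t \<partial>lborel)
        \<le> (\<integral>\<^sup>+t. ennreal (B * \<phi> powr (1/s2)) * (ennreal (t powr (\<epsilon> - 1)) * indicator {0<..T} t)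
             + ennreal (B * \<phi> powr (1/s1)) * (ennreal (t powr (- 1 - \<epsilon>)) * indicator {T<..} t) \<partial>lborel)"
        using b1 b2 B T by (intro nn_integral_mono) (auto simp: indicator_def ennreal_mult'[symmetric] ennreal_leI)
      also have "\<dots> = ennreal (B * \<phi> powr (1/s2)) * (\<integral>\<^sup>+t. ennreal (t powr (\<epsilon> - 1)) * indicator {0<..T} t \<partial>lborel)
             + ennreal (B * \<phi> powr (1/s1)) * (\<integral>\<^sup>+t. ennreal (t powr (- 1 - \<epsilon>)) * indicator {T<..} t \<partial>lborel)"
        by (simp add: nn_integral_add nn_integral_cmult)
      also have "\<dots> \<le> ennreal (B * \<phi> powr (1/s2)) * ennreal (T powr (\<epsilon> - 1 + 1) / (\<epsilon> - 1 + 1))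
             + ennreal (B * \<phi> powr (1/s1)) * ennreal (T powr (- 1 - \<epsilon> + 1) / (- (- 1 - \<epsilon>) - 1))"
        using \<epsilon> T by (intro add_mono mult_left_mono nn_integral_powr_Ioi eq_refl[OF nn_integral_powr_Ioc]) auto
      also have "\<dots> = ennreal (B * \<phi> powr (1/s2) * (T powr \<epsilon> / \<epsilon>) + B * \<phi> powr (1/s1) * (T powr (- \<epsilon>) / \<epsilon>))"
        using B \<epsilon> by (simp add: ennreal_mult'[symmetric] ennreal_plus[symmetric] del: ennreal_plus)
      also have "B * \<phi> powr (1/s2) * (T powr \<epsilon> / \<epsilon>) + B * \<phi> powr (1/s1) * (T powr (- \<epsilon>) / \<epsilon>) = A * \<phi> powr (1/s)"
      proof -
        have "\<phi> powr (1/s2) * T powr \<epsilon> = \<phi> powr (1/s2 + - 1 / n * \<epsilon>)"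
          unfolding T_def powr_powr powr_add ..
        also have "1/s2 + - 1 / n * \<epsilon> = 1/s" using s12 by simp
        finally have e1: "\<phi> powr (1/s2) * T powr \<epsilon> = \<phi> powr (1/s)" .
        have "\<phi> powr (1/s1) * T powr (- \<epsilon>) = \<phi> powr (1/s1 + - 1 / n * (- \<epsilon>))"
          unfolding T_def powr_powr powr_add ..
        also have "1/s1 + - 1 / n * (- \<epsilon>) = 1/s" using s12 by simp
        finally have e2: "\<phi> powr (1/s1) * T powr (- \<epsilon>) = \<phi> powr (1/s)" .
        have "B * \<phi> powr (1/s2) * (T powr \<epsilon> / \<epsilon>) + B * \<phi> powr (1/s1) * (T powr (- \<epsilon>) / \<epsilon>)
           = B / \<epsilon> * (\<phi> powr (1/s2) * T powr \<epsilon>) + B / \<epsilon> * (\<phi> powr (1/s1) * T powr (- \<epsilon>))"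
          by simp
        also have "\<dots> = 2 * B / \<epsilon> * \<phi> powr (1/s)" unfolding e1 e2 by simp
        also have "2 * B / \<epsilon> = A" unfolding A_def B_def by (simp add: powr_add)
        finally show ?thesis .
      qed
      finally show ?thesis .
    qed
    define X where "X = A * \<phi> powr (1/s)"
    have X: "X \<ge> 0" unfolding X_def using A by simp
    have young: "g * X \<le> g powr (s / (s - 1)) + X powr s"
    proof (cases "X \<le> g powr (1 / (s - 1))")
      case True
      have "g * X \<le> g * g powr (1 / (s - 1))" using True g by (intro mult_left_mono) auto
      also have "\<dots> = g powr (1 + 1 / (s - 1))" using g by (simp add: powr_add)
      also have "1 + 1 / (s - 1) = s / (s - 1)" using s by (simp add: field_simps)
      finally show ?thesis by (simp add: add_increasing2)
    next
      case False
      have "g = (g powr (1 / (s - 1))) powr (s - 1)" using g s by (simp add: powr_powr)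
      also have "\<dots> \<le> X powr (s - 1)" using False s by (intro powr_mono2) auto
      finally have "g * X \<le> X powr (s - 1) * X" using X by (intro mult_right_mono) auto
      also have "\<dots> = X powr s" using X by (cases "X = 0") (auto simp: powr_diff)
      finally show ?thesis by (simp add: add_increasing)
    qed
    have "ennreal g * (\<integral>\<^sup>+t. ennreal (f t) * indicator {0<..} t \<partial>lborel) \<le> ennreal g * ennreal X"
      unfolding X_def by (intro mult_left_mono total) auto
    also have "\<dots> \<le> ennreal (g powr (s / (s - 1)) + X powr s)"
      using young g X by (simp add: ennreal_mult'[symmetric] ennreal_leI del: ennreal_plus)
    also have "X powr s = C * \<phi>"
      unfolding X_def C_def using A s \<phi> by (simp add: powr_mult powr_powr)
    also have "ennreal (g powr (s / (s - 1)) + C * \<phi>) = ennreal (g powr (s / (s - 1))) + ennreal C * (?I1 + ?I2)"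
      unfolding \<phi>(1) using C \<phi>(2) by (simp add: ennreal_mult)
    finally show ?thesis .
  qed
  ultimately show ?thesis by blast
qed

lemma avg_weighted_scaled_mono:
  fixes h :: "'a::euclidean_space \<Rightarrow> real"
  assumes [measurable]: "h \<in> borel_measurable borel" and h: "\<And>y. 0 \<le> h y" and r: "1 < r"
    and H: "(\<integral>\<^sup>+y. ennreal (h y powr r) \<partial>lborel) \<le> 1" and b: "0 \<le> b" and \<rho>: "0 \<le> \<rho> x"
    and t: "0 < t" "t \<le> \<tau>"
  shows "t powr real DIM('a) * avg_weighted \<rho> b h x t \<le> \<tau> powr real DIM('a) * avg_weighted \<rho> b h x \<tau>"
proof -
  have eq: "t powr real DIM('a) * avg_weighted \<rho> b h x t = (1 + t / \<rho> x) powr b *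
     enn2real (\<integral>\<^sup>+y. ennreal (h y) * indicator (ball x t) y \<partial>lborel)" if "0 < t" for t
    unfolding avg_weighted_def using that by (simp add: powr_minus)
  have "enn2real (\<integral>\<^sup>+y. ennreal (h y) * indicator (ball x t) y \<partial>lborel)
      \<le> enn2real (\<integral>\<^sup>+y. ennreal (h y) * indicator (ball x \<tau>) y \<partial>lborel)"
    using t by (intro enn2real_mono nn_integral_mono mult_left_mono local_integral_finite[OF _ h r H, unfolded infinity_ennreal_def])
      (auto simp: indicator_def)
  moreover have "(1 + t / \<rho> x) powr b \<le> (1 + \<tau> / \<rho> x) powr b"
    using t \<rho> b by (intro powr_mono2 add_mono divide_right_mono) auto
  ultimately show ?thesis using t by (simp add: eq mult_mono)
qed

text \<open>The fractional integral of order 1 maps \<open>L^r\<close> to \<open>L^s\<close>, also with the weight. It is placed between the orders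
\<open>1 + \<epsilon>\<close> and \<open>1 - \<epsilon>\<close>; the strict inequality \<open>b s < \<gamma>\<close> leaves room for the target exponent
\<open>s1 > s\<close> belonging to the larger order.\<close>

lemma weighted_fractional_integral_bilinear:
  fixes \<rho> :: "'a::euclidean_space \<Rightarrow> real" and b r s \<gamma> K :: real
  defines "n \<equiv> real DIM('a)"
  assumes \<rho>m[measurable]: "\<rho> \<in> borel_measurable borel" and \<rho>: "\<And>x. 0 \<le> \<rho> x"
    and r: "1 < r" and b: "0 \<le> b" and s: "0 < s" and scal: "1/s = 1/r - 1/n"
    and \<gamma>: "b * s < \<gamma>"
    and K: "\<And>g. 0 \<le> g \<Longrightarrow> g < \<gamma> \<Longrightarrow> \<exists>K>0. \<forall>y t. 0 < t \<longrightarrow>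
      (\<integral>\<^sup>+x. ennreal ((1 + t / \<rho> x) powr g) * indicator (ball y t) x \<partial>lborel) \<le> ennreal (K * t powr n)"
  shows "\<exists>C>0. \<forall>g \<in> borel_measurable borel. \<forall>h \<in> borel_measurable borel.
     (\<forall>x. 0 \<le> g x) \<longrightarrow> (\<forall>y. 0 \<le> h y) \<longrightarrow>
     (\<integral>\<^sup>+x. ennreal (g x powr (s / (s - 1))) \<partial>lborel) \<le> 1 \<longrightarrow> (\<integral>\<^sup>+y. ennreal (h y powr r) \<partial>lborel) \<le> 1 \<longrightarrow>
     (\<integral>\<^sup>+x. ennreal (g x) * (\<integral>\<^sup>+t. ennreal (avg_weighted \<rho> b h x t) * indicator {0<..} t \<partial>lborel) \<partial>lborel) \<le> ennreal C"
proof -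
  have n: "n \<ge> 1" unfolding n_def using DIM_positive[where 'a='a] by linarith
  have rs: "r < s" proof -
    have "1 / n > 0" using n by simp
    then have "1/s < 1/r" using scal by linarith
    then show ?thesis using r s by (simp add: field_simps)
  qed
  \<comment> \<open>\<open>\<epsilon>\<close> is small enough to keep \<open>b s1 < \<gamma>\<close> and \<open>s1\<close> finite\<close>
  have lim: "((\<lambda>\<epsilon>. 1 / (1/s - \<epsilon>/n)) \<longlongrightarrow> s) (at_right 0)"
    using s n by (auto intro!: tendsto_eq_intros)
  have ev: "\<forall>\<^sub>F \<epsilon> in at_right 0. b * (1 / (1/s - \<epsilon>/n)) < \<gamma>"
    using \<gamma> by (intro order_tendstoD(2)[OF tendsto_mult[OF tendsto_const lim]])
  have "\<forall>\<^sub>F \<epsilon> in at_right 0. \<epsilon> < n/s"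
    using s n by (intro order_tendstoD(2)[OF tendsto_ident_at]) auto
  moreover have "\<forall>\<^sub>F \<epsilon> in at_right 0. \<epsilon> < (1::real)"
    by (intro order_tendstoD(2)[OF tendsto_ident_at]) auto
  ultimately have "\<forall>\<^sub>F \<epsilon> in at_right 0. \<epsilon> > 0 \<and> \<epsilon> < 1 \<and> \<epsilon> < n/s \<and> b * (1 / (1/s - \<epsilon>/n)) < \<gamma>"
    using ev eventually_at_right_less[of "0::real"] by eventually_elim auto
  then obtain \<epsilon> where \<epsilon>: "0 < \<epsilon>" "\<epsilon> < 1" "\<epsilon> < n/s" "b * (1 / (1/s - \<epsilon>/n)) < \<gamma>"
    by (metis (mono_tags, lifting) eventually_happens trivial_limit_at_right_real)
  define s1 where "s1 = 1 / (1/s - \<epsilon>/n)"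
  define s2 where "s2 = 1 / (1/s + \<epsilon>/n)"
  have s1': "1/s1 = 1/s - \<epsilon>/n" and s2': "1/s2 = 1/s + \<epsilon>/n" unfolding s1_def s2_def by auto
  have p1: "1/s - \<epsilon>/n > 0" using \<epsilon> n s by (simp add: field_simps)
  have "1/s - \<epsilon>/n < 1/s" using \<epsilon> n by simp
  then have "1 / (1/s) < 1 / (1/s - \<epsilon>/n)" using p1 using s by (intro divide_strict_left_mono mult_pos_pos) auto
  then have "s < s1" unfolding s1_def by simp
  then have s1: "r < s1" "b * s1 < \<gamma>" using rs \<epsilon>(4) unfolding s1_def by auto
  have p2: "0 < 1/s + \<epsilon>/n" using \<epsilon> n s by (intro add_pos_pos) auto
  have "1/s + \<epsilon>/n < 1/r" using scal \<epsilon> n by (simp add: divide_strict_right_mono)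
  then have r_s2: "r < s2" unfolding s2_def using p2 r by (simp add: field_simps)
  have "1/s < 1/s + \<epsilon>/n" using \<epsilon> n by simp
  then have "1 / (1/s + \<epsilon>/n) < 1 / (1/s)" using p2 s by (intro divide_strict_left_mono mult_pos_pos) auto
  then have s2s: "s2 < s" unfolding s2_def by simp
  have s2: "r < s2" "b * s2 < \<gamma>"
    using r_s2 order_le_less_trans[OF mult_left_mono[OF less_imp_le[OF s2s] b] \<gamma>] by auto
  obtain K1 where K1: "K1 > 0" "\<And>y t. 0 < t \<Longrightarrow>
      (\<integral>\<^sup>+x. ennreal ((1 + t / \<rho> x) powr (b * s1)) * indicator (ball y t) x \<partial>lborel) \<le> ennreal (K1 * t powr n)"
    using K[of "b * s1"] s1 r b by auto
  obtain K2 where K2: "K2 > 0" "\<And>y t. 0 < t \<Longrightarrow>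
      (\<integral>\<^sup>+x. ennreal ((1 + t / \<rho> x) powr (b * s2)) * indicator (ball y t) x \<partial>lborel) \<le> ennreal (K2 * t powr n)"
    using K[of "b * s2"] s2 r b by auto
  have sc1: "1/s1 = 1/r - (1 + \<epsilon>)/n" unfolding s1' scal by (simp add: add_divide_distrib)
  have sc2: "1/s2 = 1/r - (1 - \<epsilon>)/n" unfolding s2' scal by (simp add: diff_divide_distrib)
  obtain C1 where C1: "C1 > 0" "\<And>h. h \<in> borel_measurable borel \<Longrightarrow> (\<forall>y. 0 \<le> h y) \<Longrightarrow> (\<integral>\<^sup>+y. ennreal (h y powr r) \<partial>lborel) \<le> 1 \<Longrightarrow>
     (\<integral>\<^sup>+x. \<integral>\<^sup>+t. ennreal ((t powr (1 + \<epsilon>) * avg_weighted \<rho> b h x t) powr s1 / t) * indicator {0<..} t \<partial>lborel \<partial>lborel) \<le> ennreal C1"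
    using scale_estimate[of \<rho> r "1 + \<epsilon>" s1 K1 b] sc1 K1 r s1 \<epsilon> \<rho> \<rho>m unfolding n_def by auto
  obtain C2 where C2: "C2 > 0" "\<And>h. h \<in> borel_measurable borel \<Longrightarrow> (\<forall>y. 0 \<le> h y) \<Longrightarrow> (\<integral>\<^sup>+y. ennreal (h y powr r) \<partial>lborel) \<le> 1 \<Longrightarrow>
     (\<integral>\<^sup>+x. \<integral>\<^sup>+t. ennreal ((t powr (1 - \<epsilon>) * avg_weighted \<rho> b h x t) powr s2 / t) * indicator {0<..} t \<partial>lborel \<partial>lborel) \<le> ennreal C2"
    using scale_estimate[of \<rho> r "1 - \<epsilon>" s2 K2 b] sc2 K2 r s2 \<epsilon> \<rho> \<rho>m unfolding n_def by auto
  obtain C where C: "C > 0" "\<And>f g. f \<in> borel_measurable borel \<Longrightarrow> g \<ge> 0 \<Longrightarrow> (\<forall>t>0. 0 \<le> f t) \<Longrightarrow>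
     (\<forall>t \<tau>. 0 < t \<longrightarrow> t \<le> \<tau> \<longrightarrow> t powr n * f t \<le> \<tau> powr n * f \<tau>) \<Longrightarrow>
     ennreal g * (\<integral>\<^sup>+t. ennreal (f t) * indicator {0<..} t \<partial>lborel) \<le> ennreal (g powr (s / (s - 1))) +
       ennreal C * ((\<integral>\<^sup>+t. ennreal ((t powr (1 + \<epsilon>) * f t) powr s1 / t) * indicator {0<..} t \<partial>lborel) +
         (\<integral>\<^sup>+t. ennreal ((t powr (1 - \<epsilon>) * f t) powr s2 / t) * indicator {0<..} t \<partial>lborel))"
    using scale_interpolation[of n \<epsilon> s s1 s2] n \<epsilon> r rs s1 s2 s1' s2' by auto
  have "(\<integral>\<^sup>+x. ennreal (g x) * (\<integral>\<^sup>+t. ennreal (avg_weighted \<rho> b h x t) * indicator {0<..} t \<partial>lborel) \<partial>lborel) \<le> ennreal (1 + C * (C1 + C2))"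
    if gm[measurable]: "g \<in> borel_measurable borel" and hm[measurable]: "h \<in> borel_measurable borel"
      and g: "\<forall>x. 0 \<le> g x" and h: "\<forall>y. 0 \<le> h y"
      and G: "(\<integral>\<^sup>+x. ennreal (g x powr (s / (s - 1))) \<partial>lborel) \<le> 1"
      and H: "(\<integral>\<^sup>+y. ennreal (h y powr r) \<partial>lborel) \<le> 1" for g h :: "'a \<Rightarrow> real"
  proof -
    let ?F1 = "\<lambda>x. \<integral>\<^sup>+t. ennreal ((t powr (1 + \<epsilon>) * avg_weighted \<rho> b h x t) powr s1 / t) * indicator {0<..} t \<partial>lborel"
    let ?F2 = "\<lambda>x. \<integral>\<^sup>+t. ennreal ((t powr (1 - \<epsilon>) * avg_weighted \<rho> b h x t) powr s2 / t) * indicator {0<..} t \<partial>lborel"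
    have "(\<integral>\<^sup>+x. ennreal (g x) * (\<integral>\<^sup>+t. ennreal (avg_weighted \<rho> b h x t) * indicator {0<..} t \<partial>lborel) \<partial>lborel)
      \<le> (\<integral>\<^sup>+x. ennreal (g x powr (s / (s - 1))) + ennreal C * (?F1 x + ?F2 x) \<partial>lborel)"
    proof (intro nn_integral_mono C(2))
      fix x
      show "\<forall>t \<tau>. 0 < t \<longrightarrow> t \<le> \<tau> \<longrightarrow> t powr n * avg_weighted \<rho> b h x t \<le> \<tau> powr n * avg_weighted \<rho> b h x \<tau>"
        using avg_weighted_scaled_mono[where h=h and r=r and b=b and \<rho>=\<rho> and x=x] h r H b \<rho> unfolding n_def by auto
    qed (use g in auto)
    also have "\<dots> = (\<integral>\<^sup>+x. ennreal (g x powr (s / (s - 1))) \<partial>lborel) + ennreal C * ((\<integral>\<^sup>+x. ?F1 x \<partial>lborel) + (\<integral>\<^sup>+x. ?F2 x \<partial>lborel))"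
      by (simp add: nn_integral_add nn_integral_cmult)
    also have "\<dots> \<le> 1 + ennreal C * (ennreal C1 + ennreal C2)"
      by (intro add_mono mult_left_mono G C1 C2 hm h H) auto
    also have "\<dots> = ennreal (1 + C * (C1 + C2))"
      using C C1 C2 by (simp add: ennreal_mult)
    finally show ?thesis .
  qed
  moreover have "1 + C * (C1 + C2) > 0" using C C1 C2 by (intro add_pos_pos mult_pos_pos) auto
  ultimately show ?thesis by blast
qed

section \<open>Averages of the gradient\<close>

lemma nn_integral_ball_scale:
  fixes k :: "'a::euclidean_space \<Rightarrow> ennreal"
  assumes [measurable]: "k \<in> borel_measurable borel" and t: "0 < t"
  shows "(\<integral>\<^sup>+z. k (x + t *\<^sub>R z) * indicator (ball 0 1) z \<partial>lborel)
       = ennreal (t powr (- real DIM('a))) * (\<integral>\<^sup>+y. k y * indicator (ball x t) y \<partial>lborel)"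
proof -
  have "(\<integral>\<^sup>+y. k y * indicator (ball x t) y \<partial>lborel)
     = (\<integral>\<^sup>+y. k y * indicator (ball x t) y \<partial>density (distr lborel borel (\<lambda>z. x + t *\<^sub>R z)) (\<lambda>_. \<bar>t\<bar>^DIM('a)))"
    using t lborel_affine[of t x]
    by (intro arg_cong[where f="\<lambda>M. \<integral>\<^sup>+y. k y * indicator (ball x t) y \<partial>M"]) simp
  also have "\<dots> = (\<integral>\<^sup>+z. ennreal (t ^ DIM('a)) * (k (x + t *\<^sub>R z) * indicator (ball x t) (x + t *\<^sub>R z)) \<partial>lborel)"
    using t by (simp add: nn_integral_density nn_integral_distr)
  also have "\<dots> = (\<integral>\<^sup>+z. ennreal (t ^ DIM('a)) * (k (x + t *\<^sub>R z) * indicator (ball 0 1) z) \<partial>lborel)"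
    using t by (intro nn_integral_cong) (auto simp: indicator_def dist_norm)
  also have "\<dots> = ennreal (t ^ DIM('a)) * (\<integral>\<^sup>+z. k (x + t *\<^sub>R z) * indicator (ball 0 1) z \<partial>lborel)"
    by (simp add: nn_integral_cmult)
  finally have eq: "(\<integral>\<^sup>+y. k y * indicator (ball x t) y \<partial>lborel) = ennreal (t ^ DIM('a)) * (\<integral>\<^sup>+z. k (x + t *\<^sub>R z) * indicator (ball 0 1) z \<partial>lborel)" .
  have "t powr (- real DIM('a)) * t ^ DIM('a) = 1"
    using t by (simp add: powr_minus powr_realpow)
  then have "ennreal (t powr (- real DIM('a))) * ennreal (t ^ DIM('a)) = 1"
    using t by (simp only: ennreal_mult'[symmetric] powr_ge_zero ennreal_1)
  then show ?thesis
    unfolding eq mult.assoc[symmetric] by simp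
qed

text \<open>The function vanishes far out on the ray, and a direction of norm at most 1 does not increase the
derivative along it.\<close>

lemma gradient_ray_bound:
  fixes u :: "'a::euclidean_space \<Rightarrow> real" and D :: "'a \<Rightarrow> 'a"
  assumes D: "\<And>x. (u has_derivative (\<lambda>v. v \<bullet> D x)) (at x)" and cont: "continuous_on UNIV D"
    and supp: "bounded {x. u x \<noteq> 0}" and z: "z \<noteq> 0" "norm z \<le> 1"
  shows "ennreal \<bar>u x\<bar> \<le> (\<integral>\<^sup>+t. ennreal (norm (D (x + t *\<^sub>R z))) * indicator {0<..} t \<partial>lborel)"
proof -
  obtain B where B: "\<And>y. u y \<noteq> 0 \<Longrightarrow> norm y \<le> B" using supp unfolding bounded_iff by auto
  define T where "T = (\<bar>B\<bar> + norm x + 1) / norm z"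
  have T: "T > 0" unfolding T_def using z by (intro divide_pos_pos) (auto intro: add_nonneg_pos)
  have "u (x + T *\<^sub>R z) = 0"
  proof (rule ccontr)
    assume "u (x + T *\<^sub>R z) \<noteq> 0"
    then have "norm (x + T *\<^sub>R z) \<le> B" by (rule B)
    moreover have "norm (T *\<^sub>R z) = \<bar>B\<bar> + norm x + 1" unfolding T_def using z by simp
    ultimately show False using norm_diff_ineq[of "T *\<^sub>R z" x] by (simp add: add.commute)
  qed
  have der: "((\<lambda>t. u (x + t *\<^sub>R z)) has_vector_derivative (z \<bullet> D (x + t *\<^sub>R z))) (at t within {0..T})" for t
  proof -
    have "((\<lambda>t. x + t *\<^sub>R z) has_derivative (\<lambda>s. s *\<^sub>R z)) (at t within {0..T})"
      by (auto intro!: derivative_eq_intros)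
    from has_derivative_compose[OF this D] show ?thesis
      unfolding has_vector_derivative_def by (simp add: mult.commute)
  qed
  have contD: "continuous_on {0..T} (\<lambda>t. D (x + t *\<^sub>R z))"
    by (intro continuous_on_compose2[OF cont] continuous_intros) auto
  have I: "((\<lambda>t. z \<bullet> D (x + t *\<^sub>R z)) has_integral (u (x + T *\<^sub>R z) - u (x + 0 *\<^sub>R z))) {0..T}"
    using T der by (intro fundamental_theorem_of_calculus) auto
  have intD: "(\<lambda>t. norm (D (x + t *\<^sub>R z))) integrable_on {0..T}"
    by (intro integrable_continuous_interval continuous_intros contD)
  have "norm (integral {0..T} (\<lambda>t. z \<bullet> D (x + t *\<^sub>R z))) \<le> integral {0..T} (\<lambda>t. norm (D (x + t *\<^sub>R z)))"
  proof (rule integral_norm_bound_integral)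
    show "(\<lambda>t. z \<bullet> D (x + t *\<^sub>R z)) integrable_on {0..T}" using I by blast
    show "norm (z \<bullet> D (x + t *\<^sub>R z)) \<le> norm (D (x + t *\<^sub>R z))" for t
      using Cauchy_Schwarz_ineq2[of z "D (x + t *\<^sub>R z)"] mult_right_mono[OF z(2), of "norm (D (x + t *\<^sub>R z))"] by simp
  qed (rule intD)
  also have "integral {0..T} (\<lambda>t. z \<bullet> D (x + t *\<^sub>R z)) = - u x"
    using integral_unique[OF I] \<open>u (x + T *\<^sub>R z) = 0\<close> by simp
  finally have "\<bar>u x\<bar> \<le> integral {0..T} (\<lambda>t. norm (D (x + t *\<^sub>R z)))" by simp
  then have "ennreal \<bar>u x\<bar> \<le> ennreal (integral {0..T} (\<lambda>t. norm (D (x + t *\<^sub>R z))))"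
    by (rule ennreal_leI)
  also have "\<dots> = (\<integral>\<^sup>+t. ennreal (norm (D (x + t *\<^sub>R z))) * indicator {0..T} t \<partial>lborel)"
    using integrable_integral[OF intD] by (intro nn_integral_has_integral_lebesgue'[symmetric]) auto
  also have "\<dots> \<le> (\<integral>\<^sup>+t. ennreal (norm (D (x + t *\<^sub>R z))) * indicator {0<..} t \<partial>lborel)"
    using AE_lborel_singleton[of "0::real"]
    by (intro nn_integral_mono_AE) (auto simp: indicator_def elim!: eventually_mono)
  finally show ?thesis .
qed

text \<open>The integral of \<open>gradient_ray_bound\<close> over all \<open>z\<close> in the unit ball, where \<open>y = x + t z\<close> is substituted for
\<open>z\<close> at fixed \<open>t\<close>. This avoids polar coordinates.\<close>

lemma gradient_average_bound:
  fixes u :: "'a::euclidean_space \<Rightarrow> real" and D :: "'a \<Rightarrow> 'a"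
  assumes D: "\<And>x. (u has_derivative (\<lambda>v. v \<bullet> D x)) (at x)" and cont: "continuous_on UNIV D"
    and supp: "bounded {x. u x \<noteq> 0}"
  shows "ennreal (unit_ball_vol (real DIM('a)) * \<bar>u x\<bar>)
    \<le> (\<integral>\<^sup>+t. ennreal (t powr (- real DIM('a))) *
         (\<integral>\<^sup>+y. ennreal (norm (D y)) * indicator (ball x t) y \<partial>lborel) * indicator {0<..} t \<partial>lborel)"
proof -
  have [measurable]: "D \<in> borel_measurable borel" using cont by (rule borel_measurable_continuous_onI)
  have "ennreal (unit_ball_vol (real DIM('a)) * \<bar>u x\<bar>) = (\<integral>\<^sup>+z. ennreal \<bar>u x\<bar> * indicator (ball (0::'a) 1) z \<partial>lborel)"
    by (simp add: nn_integral_cmult_indicator emeasure_ball ennreal_mult'' mult.commute unit_ball_vol_nonneg)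
  also have "\<dots> \<le> (\<integral>\<^sup>+z. (\<integral>\<^sup>+t. ennreal (norm (D (x + t *\<^sub>R z))) * indicator {0<..} t \<partial>lborel) * indicator (ball 0 1) z \<partial>lborel)"
    using AE_lborel_singleton[of "0::'a"]
  proof (intro nn_integral_mono_AE, eventually_elim)
    fix z :: 'a assume "z \<noteq> 0"
    then show "ennreal \<bar>u x\<bar> * indicator (ball 0 1) z \<le>
      (\<integral>\<^sup>+t. ennreal (norm (D (x + t *\<^sub>R z))) * indicator {0<..} t \<partial>lborel) * indicator (ball 0 1) z"
      using gradient_ray_bound[OF D cont supp, of z x] by (cases "norm z < 1") auto
  qed
  also have "\<dots> = (\<integral>\<^sup>+z. (\<integral>\<^sup>+t. ennreal (norm (D (x + t *\<^sub>R z))) * indicator {0<..} t * indicator (ball 0 1) z \<partial>lborel) \<partial>lborel)"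
    by (simp add: nn_integral_multc)
  also have "\<dots> = (\<integral>\<^sup>+t. (\<integral>\<^sup>+z. ennreal (norm (D (x + t *\<^sub>R z))) * indicator {0<..} t * indicator (ball 0 1) z \<partial>lborel) \<partial>lborel)"
    by (rule lborel_pair.Fubini') measurable
  also have "\<dots> = (\<integral>\<^sup>+t. ennreal (t powr (- real DIM('a))) *
         (\<integral>\<^sup>+y. ennreal (norm (D y)) * indicator (ball x t) y \<partial>lborel) * indicator {0<..} t \<partial>lborel)"
  proof (intro nn_integral_cong)
    fix t :: real
    show "(\<integral>\<^sup>+z. ennreal (norm (D (x + t *\<^sub>R z))) * indicator {0<..} t * indicator (ball 0 1) z \<partial>lborel)
       = ennreal (t powr (- real DIM('a))) * (\<integral>\<^sup>+y. ennreal (norm (D y)) * indicator (ball x t) y \<partial>lborel) * indicator {0<..} t"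
    proof (cases "0 < t")
      case True
      then show ?thesis using nn_integral_ball_scale[of "\<lambda>y. ennreal (norm (D y))" t x] by simp
    qed simp
  qed
  finally show ?thesis .
qed

text \<open>The gradient is assembled from the partial derivatives, which are continuous by assumption.\<close>

lemma C_1_gradient:
  fixes u :: "'a::euclidean_space \<Rightarrow> real"
  assumes "C_k 1 u"
  shows "(u has_derivative (\<lambda>v. v \<bullet> grad u x)) (at x)" and "continuous_on UNIV (grad u)"
proof -
  have d: "u differentiable (at x)" and c: "i \<in> Basis \<Longrightarrow> continuous_on UNIV (\<lambda>x. frechet_derivative u (at x) i)" for x i
    using assms by auto
  define G where "G x = (\<Sum>i\<in>Basis. frechet_derivative u (at x) i *\<^sub>R i)" for x
  have G: "(u has_derivative (\<lambda>v. v \<bullet> G x)) (at x)" for x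
  proof -
    have D: "(u has_derivative frechet_derivative u (at x)) (at x)" using d frechet_derivative_works by blast
    then have lin: "linear (frechet_derivative u (at x))" by (rule has_derivative_linear)
    have "frechet_derivative u (at x) = (\<lambda>v. v \<bullet> G x)"
    proof
      fix v
      have "frechet_derivative u (at x) v = frechet_derivative u (at x) (\<Sum>i\<in>Basis. (v \<bullet> i) *\<^sub>R i)"
        by (simp add: euclidean_representation)
      also have "\<dots> = (\<Sum>i\<in>Basis. (v \<bullet> i) * frechet_derivative u (at x) i)"
        using lin by (simp add: linear_sum linear_cmul)
      also have "\<dots> = v \<bullet> G x" unfolding G_def by (simp add: inner_sum_right mult.commute)
      finally show "frechet_derivative u (at x) v = v \<bullet> G x" .
    qed
    with D show ?thesis by simp
  qed
  have gr: "grad u x = G x" for x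
  proof -
    have "GDERIV u x :> G x" unfolding gderiv_def by (rule G)
    moreover have "D = G x" if "GDERIV u x :> D" for D
    proof -
      have "(\<lambda>v. v \<bullet> D) = (\<lambda>v. v \<bullet> G x)"
        using that G[of x] unfolding gderiv_def by (rule has_derivative_unique)
      from fun_cong[OF this, of "D - G x"] have "(D - G x) \<bullet> D = (D - G x) \<bullet> G x" .
      then have "(D - G x) \<bullet> (D - G x) = 0" by (simp add: inner_diff_right)
      then show ?thesis by simp
    qed
    ultimately show ?thesis unfolding grad_def by blast
  qed
  show "(u has_derivative (\<lambda>v. v \<bullet> grad u x)) (at x)" unfolding gr by (rule G)
  have "continuous_on UNIV G" unfolding G_def by (intro continuous_intros c)
  moreover have "grad u = G" by (rule ext) (rule gr)
  ultimately show "continuous_on UNIV (grad u)" by (simp only:)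
qed

section \<open>The weighted Sobolev inequality\<close>

lemma distance_weight_ball_integral':
  fixes E :: "'a::euclidean_space set" and d g :: real
  assumes E: "closed E" "E \<noteq> {}" "assouad_dim E = ereal d" and g: "0 \<le> g" "g < real DIM('a) - d"
  shows "\<exists>K>0. \<forall>y t. 0 < t \<longrightarrow>
      (\<integral>\<^sup>+x. ennreal ((1 + t / infdist x E) powr g) * indicator (ball y t) x \<partial>lborel) \<le> ennreal (K * t powr real DIM('a))"
proof -
  have dim: "assouad_dim E < ereal (real DIM('a) - g)" using E g by simp
  show ?thesis
    by (rule distance_weight_ball_integral[OF E(1,2) dim g(1)]) (auto simp: powr_realpow)
qed

lemma infdist_powr_ratio:
  fixes x y :: "'a::euclidean_space"
  assumes "0 \<le> b" "0 < infdist x E" "dist x y < t"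
  shows "infdist x E powr (- b) * infdist y E powr b \<le> (1 + t / infdist x E) powr b"
proof -
  have "infdist y E \<le> infdist x E + t"
    using infdist_triangle[of y E x] assms by (simp add: dist_commute)
  then have "infdist y E / infdist x E \<le> 1 + t / infdist x E"
    using assms by (simp add: field_simps)
  then have "(infdist y E / infdist x E) powr b \<le> (1 + t / infdist x E) powr b"
    using assms by (intro powr_mono2) (auto simp: infdist_nonneg)
  then show ?thesis by (simp add: powr_divide infdist_nonneg powr_minus field_simps)
qed

lemma AE_infdist_pos:
  fixes E :: "'a::euclidean_space set"
  assumes E: "closed E" "E \<noteq> {}" "assouad_dim E = ereal d" "d < real DIM('a)"
  shows "AE x in lborel. 0 < infdist x E"
proof -
  have "E \<in> null_sets lborel" using E by (intro null_set_of_assouad_dim_less) auto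
  then have "AE x in lborel. x \<notin> E" by (rule AE_not_in)
  then show ?thesis
    by eventually_elim (use E in \<open>auto simp: order_less_le infdist_nonneg in_closed_iff_infdist_zero\<close>)
qed

text \<open>The Sobolev inequality for \<open>a \<ge> 0\<close>, tested against \<open>\<phi>\<close>. The factor \<open>k h\<close> stands for \<open>|\<nabla>u| \<delta>^(-a)\<close>, with
\<open>k\<close> its norm. Here the weight \<open>(1 + t/\<delta>(x))^a\<close> sits at the centre \<open>x\<close> of the averages of \<open>h\<close>.\<close>

lemma dual_bound_nonneg:
  fixes E :: "'a::euclidean_space set" and a d p q :: real
  defines "n \<equiv> real DIM('a)"
  assumes E: "closed E" "E \<noteq> {}" "assouad_dim E = ereal d" "d < n"
    and p: "1 < p" and q: "0 < q" and pq: "1/q = 1/p - 1/n" and a: "0 \<le> a" "a * q < n - d"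
  shows "\<exists>C>0. \<forall>u h \<phi> k. C_k 1 u \<longrightarrow> bounded {x. u x \<noteq> 0} \<longrightarrow> 0 \<le> k \<longrightarrow>
    h \<in> borel_measurable borel \<longrightarrow> \<phi> \<in> borel_measurable borel \<longrightarrow> (\<forall>x. 0 \<le> h x) \<longrightarrow> (\<forall>x. 0 \<le> \<phi> x) \<longrightarrow>
    (AE y in lborel. norm (grad u y) = k * (h y * infdist y E powr a)) \<longrightarrow>
    (\<integral>\<^sup>+y. ennreal (h y powr p) \<partial>lborel) \<le> 1 \<longrightarrow> (\<integral>\<^sup>+x. ennreal (\<phi> x powr (q / (q - 1))) \<partial>lborel) \<le> 1 \<longrightarrow>
    (\<integral>\<^sup>+x. ennreal (\<phi> x * (unit_ball_vol n * (\<bar>u x\<bar> * infdist x E powr (- a)))) \<partial>lborel) \<le> ennreal (C * k)"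
proof -
  obtain C where C: "C > 0" "\<And>g h. g \<in> borel_measurable borel \<Longrightarrow> h \<in> borel_measurable borel \<Longrightarrow>
     (\<forall>x. 0 \<le> g x) \<Longrightarrow> (\<forall>y. 0 \<le> h y) \<Longrightarrow>
     (\<integral>\<^sup>+x. ennreal (g x powr (q / (q - 1))) \<partial>lborel) \<le> 1 \<Longrightarrow> (\<integral>\<^sup>+y. ennreal (h y powr p) \<partial>lborel) \<le> 1 \<Longrightarrow>
     (\<integral>\<^sup>+x. ennreal (g x) * (\<integral>\<^sup>+t. ennreal (avg_weighted (\<lambda>x. infdist x E) a h x t) * indicator {0<..} t \<partial>lborel) \<partial>lborel) \<le> ennreal C"
    using weighted_fractional_integral_bilinear[of "\<lambda>x. infdist x E" p a q "n - d"]
      distance_weight_ball_integral'[OF E(1-3)] p q pq a unfolding n_def by (auto simp: infdist_nonneg)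
  have "(\<integral>\<^sup>+x. ennreal (\<phi> x * (unit_ball_vol n * (\<bar>u x\<bar> * infdist x E powr (- a)))) \<partial>lborel) \<le> ennreal (C * k)"
    if u: "C_k 1 u" "bounded {x. u x \<noteq> 0}" and k: "0 \<le> k"
      and [measurable]: "h \<in> borel_measurable borel" "\<phi> \<in> borel_measurable borel"
      and h: "\<forall>x. 0 \<le> h x" and \<phi>: "\<forall>x. 0 \<le> \<phi> x"
      and gr: "AE y in lborel. norm (grad u y) = k * (h y * infdist y E powr a)"
      and H: "(\<integral>\<^sup>+y. ennreal (h y powr p) \<partial>lborel) \<le> 1"
      and P: "(\<integral>\<^sup>+x. ennreal (\<phi> x powr (q / (q - 1))) \<partial>lborel) \<le> 1" for u h \<phi> k
  proof -
    have pw: "ennreal (unit_ball_vol n * (\<bar>u x\<bar> * infdist x E powr (- a)))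
      \<le> ennreal k * (\<integral>\<^sup>+t. ennreal (avg_weighted (\<lambda>x. infdist x E) a h x t) * indicator {0<..} t \<partial>lborel)" for x
    proof (cases "infdist x E = 0")
      case False
      then have d0: "0 < infdist x E" by (simp add: order_less_le infdist_nonneg)
      have "ennreal (unit_ball_vol n * (\<bar>u x\<bar> * infdist x E powr (- a)))
         = ennreal (infdist x E powr (- a)) * ennreal (unit_ball_vol n * \<bar>u x\<bar>)"
        by (subst ennreal_mult'[symmetric]) (simp_all add: mult_ac)
      also have "\<dots> \<le> ennreal (infdist x E powr (- a)) * (\<integral>\<^sup>+t. ennreal (t powr (- n)) *
         (\<integral>\<^sup>+y. ennreal (norm (grad u y)) * indicator (ball x t) y \<partial>lborel) * indicator {0<..} t \<partial>lborel)"
        unfolding n_def using u C_1_gradient[OF u(1)] by (intro mult_left_mono gradient_average_bound) auto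
      also have "\<dots> = (\<integral>\<^sup>+t. ennreal (infdist x E powr (- a)) * (ennreal (t powr (- n)) *
         (\<integral>\<^sup>+y. ennreal (norm (grad u y)) * indicator (ball x t) y \<partial>lborel) * indicator {0<..} t) \<partial>lborel)"
      proof (rule nn_integral_cmult[symmetric])
        have [measurable]: "grad u \<in> borel_measurable borel"
          using C_1_gradient(2)[OF u(1)] by (rule borel_measurable_continuous_onI)
        show "(\<lambda>t. ennreal (t powr (- n)) *
         (\<integral>\<^sup>+y. ennreal (norm (grad u y)) * indicator (ball x t) y \<partial>lborel) * indicator {0<..} t) \<in> borel_measurable lborel"
          by measurable
      qed
      also have "\<dots> \<le> (\<integral>\<^sup>+t. ennreal k * (ennreal (avg_weighted (\<lambda>x. infdist x E) a h x t) * indicator {0<..} t) \<partial>lborel)"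
      proof (intro nn_integral_mono)
        fix t :: real
        show "ennreal (infdist x E powr (- a)) * (ennreal (t powr (- n)) *
           (\<integral>\<^sup>+y. ennreal (norm (grad u y)) * indicator (ball x t) y \<partial>lborel) * indicator {0<..} t)
          \<le> ennreal k * (ennreal (avg_weighted (\<lambda>x. infdist x E) a h x t) * indicator {0<..} t)"
        proof (cases "0 < t")
          case True
          define w where "w = (1 + t / infdist x E) powr a"
          have "ennreal (infdist x E powr (- a)) * (\<integral>\<^sup>+y. ennreal (norm (grad u y)) * indicator (ball x t) y \<partial>lborel)
            = ennreal (infdist x E powr (- a)) * (\<integral>\<^sup>+y. ennreal (k * (h y * infdist y E powr a)) * indicator (ball x t) y \<partial>lborel)"
            using gr by (intro arg_cong2[where f="(*)"] nn_integral_cong_AE refl) (auto elim: eventually_mono)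
          also have "\<dots> = (\<integral>\<^sup>+y. ennreal (infdist x E powr (- a)) * (ennreal (k * (h y * infdist y E powr a)) * indicator (ball x t) y) \<partial>lborel)"
            by (rule nn_integral_cmult[symmetric]) measurable
          also have "\<dots> \<le> (\<integral>\<^sup>+y. ennreal (k * w) * (ennreal (h y) * indicator (ball x t) y) \<partial>lborel)"
          proof (intro nn_integral_mono)
            fix y
            show "ennreal (infdist x E powr (- a)) * (ennreal (k * (h y * infdist y E powr a)) * indicator (ball x t) y)
              \<le> ennreal (k * w) * (ennreal (h y) * indicator (ball x t) y)"
            proof (cases "y \<in> ball x t")
              case True
              have "k * h y * (infdist x E powr (- a) * infdist y E powr a) \<le> k * h y * w"
                unfolding w_def using a d0 True k h by (intro mult_left_mono infdist_powr_ratio) auto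
              then have "infdist x E powr (- a) * (k * (h y * infdist y E powr a)) \<le> k * w * h y"
                by (simp add: mult_ac)
              then show ?thesis using True k h
                by (simp add: ennreal_mult'[symmetric] ennreal_leI w_def)
            qed simp
          qed
          also have "\<dots> = ennreal (k * w) * (\<integral>\<^sup>+y. ennreal (h y) * indicator (ball x t) y \<partial>lborel)"
            by (rule nn_integral_cmult) measurable
          finally have le: "ennreal (infdist x E powr (- a)) * (\<integral>\<^sup>+y. ennreal (norm (grad u y)) * indicator (ball x t) y \<partial>lborel)
            \<le> ennreal (k * w) * (\<integral>\<^sup>+y. ennreal (h y) * indicator (ball x t) y \<partial>lborel)" .
          have fin: "(\<integral>\<^sup>+y. ennreal (h y) * indicator (ball x t) y \<partial>lborel) < \<infinity>"
            using h p H True by (intro local_integral_finite[where r=p]) auto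
          have "ennreal (infdist x E powr (- a)) * (ennreal (t powr (- n)) * (\<integral>\<^sup>+y. ennreal (norm (grad u y)) * indicator (ball x t) y \<partial>lborel))
             \<le> ennreal (t powr (- n)) * (ennreal (k * w) * (\<integral>\<^sup>+y. ennreal (h y) * indicator (ball x t) y \<partial>lborel))"
            using mult_left_mono[OF le, of "ennreal (t powr (- n))"] by (simp add: mult_ac)
          also have "\<dots> = ennreal (t powr (- n)) * (ennreal (k * w) * ennreal (enn2real (\<integral>\<^sup>+y. ennreal (h y) * indicator (ball x t) y \<partial>lborel)))"
            using fin by (simp add: less_top[symmetric])
          also have "\<dots> = ennreal k * ennreal (avg_weighted (\<lambda>x. infdist x E) a h x t)"
            unfolding avg_weighted_def w_def n_def using k by (simp add: ennreal_mult'[symmetric] mult_ac)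
          finally show ?thesis using True by simp
        qed simp
      qed
      also have "\<dots> = ennreal k * (\<integral>\<^sup>+t. ennreal (avg_weighted (\<lambda>x. infdist x E) a h x t) * indicator {0<..} t \<partial>lborel)"
        by (rule nn_integral_cmult) measurable
      finally show ?thesis .
    qed simp
    have "(\<integral>\<^sup>+x. ennreal (\<phi> x * (unit_ball_vol n * (\<bar>u x\<bar> * infdist x E powr (- a)))) \<partial>lborel)
      \<le> (\<integral>\<^sup>+x. ennreal k * (ennreal (\<phi> x) * (\<integral>\<^sup>+t. ennreal (avg_weighted (\<lambda>x. infdist x E) a h x t) * indicator {0<..} t \<partial>lborel)) \<partial>lborel)"
    proof (intro nn_integral_mono)
      fix x
      have "ennreal (\<phi> x * (unit_ball_vol n * (\<bar>u x\<bar> * infdist x E powr (- a))))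
         = ennreal (\<phi> x) * ennreal (unit_ball_vol n * (\<bar>u x\<bar> * infdist x E powr (- a)))"
        using \<phi> by (simp add: ennreal_mult')
      also have "\<dots> \<le> ennreal (\<phi> x) * (ennreal k * (\<integral>\<^sup>+t. ennreal (avg_weighted (\<lambda>x. infdist x E) a h x t) * indicator {0<..} t \<partial>lborel))"
        by (intro mult_left_mono pw) auto
      finally show "ennreal (\<phi> x * (unit_ball_vol n * (\<bar>u x\<bar> * infdist x E powr (- a))))
        \<le> ennreal k * (ennreal (\<phi> x) * (\<integral>\<^sup>+t. ennreal (avg_weighted (\<lambda>x. infdist x E) a h x t) * indicator {0<..} t \<partial>lborel))"
        by (simp add: mult_ac)
    qed
    also have "\<dots> = ennreal k * (\<integral>\<^sup>+x. ennreal (\<phi> x) * (\<integral>\<^sup>+t. ennreal (avg_weighted (\<lambda>x. infdist x E) a h x t) * indicator {0<..} t \<partial>lborel) \<partial>lborel)"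
      by (rule nn_integral_cmult) measurable
    also have "\<dots> \<le> ennreal k * ennreal C"
      using h \<phi> P H by (intro mult_left_mono C(2)) auto
    also have "\<dots> = ennreal (C * k)" using C k by (simp add: ennreal_mult'[symmetric] mult.commute)
    finally show ?thesis .
  qed
  with C(1) show ?thesis by blast
qed

text \<open>The counterpart for \<open>a = - b \<le> 0\<close>. The weight \<open>(1 + t/\<delta>(y))^b\<close> now sits at the argument of \<open>h\<close>. Exchanging the
order of integration turns \<open>h\<close> into the outer function and averages \<open>\<phi>\<close> around \<open>y\<close> instead; the exponents
become the conjugate ones of \<open>q\<close> and \<open>p\<close>, which satisfy the same scaling relation.\<close>

lemma dual_bound_neg:
  fixes E :: "'a::euclidean_space set" and b d p q :: real
  defines "n \<equiv> real DIM('a)"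
  assumes E: "closed E" "E \<noteq> {}" "assouad_dim E = ereal d" "d < n"
    and p: "1 < p" and q: "1 < q" and pq: "1/q = 1/p - 1/n" and b: "0 \<le> b" "b * (p / (p - 1)) < n - d"
  shows "\<exists>C>0. \<forall>u h \<phi> k. C_k 1 u \<longrightarrow> bounded {x. u x \<noteq> 0} \<longrightarrow> 0 \<le> k \<longrightarrow>
    h \<in> borel_measurable borel \<longrightarrow> \<phi> \<in> borel_measurable borel \<longrightarrow> (\<forall>x. 0 \<le> h x) \<longrightarrow> (\<forall>x. 0 \<le> \<phi> x) \<longrightarrow>
    (AE y in lborel. norm (grad u y) = k * (h y * infdist y E powr (- b))) \<longrightarrow>
    (\<integral>\<^sup>+y. ennreal (h y powr p) \<partial>lborel) \<le> 1 \<longrightarrow> (\<integral>\<^sup>+x. ennreal (\<phi> x powr (q / (q - 1))) \<partial>lborel) \<le> 1 \<longrightarrow>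
    (\<integral>\<^sup>+x. ennreal (\<phi> x * (unit_ball_vol n * (\<bar>u x\<bar> * infdist x E powr b))) \<partial>lborel) \<le> ennreal (C * k)"
proof -
  have n: "n > 0" unfolding n_def by simp
  define s where "s = p / (p - 1)"
  define r where "r = q / (q - 1)"
  have s: "0 < s" "s / (s - 1) = p" unfolding s_def using p by (auto simp: field_simps)
  have r: "1 < r" unfolding r_def using q by simp
  have "1 / s = 1 - 1 / p" "1 / r = 1 - 1 / q" unfolding s_def r_def using p q by (auto simp: field_simps)
  then have sr: "1 / s = 1 / r - 1 / n" using pq by simp
  obtain C where C: "C > 0" "\<And>g h. g \<in> borel_measurable borel \<Longrightarrow> h \<in> borel_measurable borel \<Longrightarrow>
     (\<forall>x. 0 \<le> g x) \<Longrightarrow> (\<forall>y. 0 \<le> h y) \<Longrightarrow>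
     (\<integral>\<^sup>+x. ennreal (g x powr p) \<partial>lborel) \<le> 1 \<Longrightarrow> (\<integral>\<^sup>+y. ennreal (h y powr r) \<partial>lborel) \<le> 1 \<Longrightarrow>
     (\<integral>\<^sup>+x. ennreal (g x) * (\<integral>\<^sup>+t. ennreal (avg_weighted (\<lambda>x. infdist x E) b h x t) * indicator {0<..} t \<partial>lborel) \<partial>lborel) \<le> ennreal C"
    using weighted_fractional_integral_bilinear[of "\<lambda>x. infdist x E" r b s "n - d"]
      distance_weight_ball_integral'[OF E(1-3)] s r sr b unfolding n_def s_def[symmetric] by (auto simp: infdist_nonneg)
  have "(\<integral>\<^sup>+x. ennreal (\<phi> x * (unit_ball_vol n * (\<bar>u x\<bar> * infdist x E powr b))) \<partial>lborel) \<le> ennreal (C * k)"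
    if u: "C_k 1 u" "bounded {x. u x \<noteq> 0}" and k: "0 \<le> k"
      and [measurable]: "h \<in> borel_measurable borel" "\<phi> \<in> borel_measurable borel"
      and h: "\<forall>x. 0 \<le> h x" and \<phi>: "\<forall>x. 0 \<le> \<phi> x"
      and gr: "AE y in lborel. norm (grad u y) = k * (h y * infdist y E powr (- b))"
      and H: "(\<integral>\<^sup>+y. ennreal (h y powr p) \<partial>lborel) \<le> 1"
      and P: "(\<integral>\<^sup>+x. ennreal (\<phi> x powr (q / (q - 1))) \<partial>lborel) \<le> 1" for u h \<phi> k
  proof -
    have [measurable]: "grad u \<in> borel_measurable borel"
      using C_1_gradient(2)[OF u(1)] by (rule borel_measurable_continuous_onI)
    define w where "w t y = ennreal ((1 + t / infdist y E) powr b * t powr (- n))" for t and y :: 'a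
    have [measurable]: "(\<lambda>z. w (f z) (g z)) \<in> borel_measurable M"
      if [measurable]: "f \<in> borel_measurable M" "g \<in> borel_measurable M" for M :: "'z measure" and f g
      unfolding w_def by measurable
    have pos: "AE y in lborel. 0 < infdist y E"
      using E unfolding n_def by (intro AE_infdist_pos) auto
    have pw: "ennreal (unit_ball_vol n * (\<bar>u x\<bar> * infdist x E powr b))
      \<le> (\<integral>\<^sup>+t. (\<integral>\<^sup>+y. ennreal k * (ennreal (h y) * w t y * indicator (ball x t) y) \<partial>lborel) * indicator {0<..} t \<partial>lborel)" for x
    proof -
      have "ennreal (unit_ball_vol n * (\<bar>u x\<bar> * infdist x E powr b))
         = ennreal (infdist x E powr b) * ennreal (unit_ball_vol n * \<bar>u x\<bar>)"
        by (simp add: ennreal_mult'[symmetric] mult_ac)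
      also have "\<dots> \<le> ennreal (infdist x E powr b) * (\<integral>\<^sup>+t. ennreal (t powr (- n)) *
         (\<integral>\<^sup>+y. ennreal (norm (grad u y)) * indicator (ball x t) y \<partial>lborel) * indicator {0<..} t \<partial>lborel)"
        unfolding n_def using u C_1_gradient[OF u(1)] by (intro mult_left_mono gradient_average_bound) auto
      also have "\<dots> = (\<integral>\<^sup>+t. ennreal (infdist x E powr b) * (ennreal (t powr (- n)) *
         (\<integral>\<^sup>+y. ennreal (norm (grad u y)) * indicator (ball x t) y \<partial>lborel) * indicator {0<..} t) \<partial>lborel)"
        by (rule nn_integral_cmult[symmetric]) measurable
      also have "\<dots> \<le> (\<integral>\<^sup>+t. (\<integral>\<^sup>+y. ennreal k * (ennreal (h y) * w t y * indicator (ball x t) y) \<partial>lborel) * indicator {0<..} t \<partial>lborel)"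
      proof (intro nn_integral_mono)
        fix t :: real
        have "ennreal (infdist x E powr b * t powr (- n)) * (\<integral>\<^sup>+y. ennreal (norm (grad u y)) * indicator (ball x t) y \<partial>lborel)
           = (\<integral>\<^sup>+y. ennreal (infdist x E powr b * t powr (- n)) * (ennreal (norm (grad u y)) * indicator (ball x t) y) \<partial>lborel)"
          by (rule nn_integral_cmult[symmetric]) measurable
        also have "\<dots> \<le> (\<integral>\<^sup>+y. ennreal k * (ennreal (h y) * w t y * indicator (ball x t) y) \<partial>lborel)"
          using gr pos
        proof (intro nn_integral_mono_AE, eventually_elim)
          fix y assume y: "norm (grad u y) = k * (h y * infdist y E powr (- b))" and d0: "0 < infdist y E"
          show "ennreal (infdist x E powr b * t powr (- n)) * (ennreal (norm (grad u y)) * indicator (ball x t) y)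
             \<le> ennreal k * (ennreal (h y) * w t y * indicator (ball x t) y)"
          proof (cases "y \<in> ball x t")
            case True
            have "(t powr (- n) * k * h y) * (infdist y E powr (- b) * infdist x E powr b) \<le> (t powr (- n) * k * h y) * (1 + t / infdist y E) powr b"
              using b d0 True k h by (intro mult_left_mono infdist_powr_ratio) (auto simp: dist_commute)
            then have "infdist x E powr b * t powr (- n) * (k * (h y * infdist y E powr (- b))) \<le> k * (h y * ((1 + t / infdist y E) powr b * t powr (- n)))"
              by (simp add: mult_ac)
            then show ?thesis using True k h unfolding y w_def
              by (simp add: ennreal_mult'[symmetric] ennreal_leI)
          qed simp
        qed
        finally have "ennreal (infdist x E powr b * t powr (- n)) * (\<integral>\<^sup>+y. ennreal (norm (grad u y)) * indicator (ball x t) y \<partial>lborel)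
          \<le> (\<integral>\<^sup>+y. ennreal k * (ennreal (h y) * w t y * indicator (ball x t) y) \<partial>lborel)" .
        then show "ennreal (infdist x E powr b) * (ennreal (t powr (- n)) *
           (\<integral>\<^sup>+y. ennreal (norm (grad u y)) * indicator (ball x t) y \<partial>lborel) * indicator {0<..} t)
          \<le> (\<integral>\<^sup>+y. ennreal k * (ennreal (h y) * w t y * indicator (ball x t) y) \<partial>lborel) * indicator {0<..} t"
          by (simp add: indicator_def ennreal_mult' mult.assoc)
      qed
      finally show ?thesis .
    qed
    have "(\<integral>\<^sup>+x. ennreal (\<phi> x * (unit_ball_vol n * (\<bar>u x\<bar> * infdist x E powr b))) \<partial>lborel)
      \<le> (\<integral>\<^sup>+x. ennreal (\<phi> x) * (\<integral>\<^sup>+t. (\<integral>\<^sup>+y. ennreal k * (ennreal (h y) * w t y * indicator (ball x t) y) \<partial>lborel) * indicator {0<..} t \<partial>lborel) \<partial>lborel)"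
      using \<phi> by (intro nn_integral_mono) (simp add: ennreal_mult' mult_left_mono pw)
    also have "\<dots> = (\<integral>\<^sup>+x. \<integral>\<^sup>+t. \<integral>\<^sup>+y. ennreal (\<phi> x) * (ennreal k * (ennreal (h y) * w t y * indicator (ball x t) y)) * indicator {0<..} t \<partial>lborel \<partial>lborel \<partial>lborel)"
    proof (intro nn_integral_cong)
      fix x
      let ?F = "\<lambda>t y. ennreal k * (ennreal (h y) * w t y * indicator (ball x t) y)"
      have "ennreal (\<phi> x) * (\<integral>\<^sup>+t. (\<integral>\<^sup>+y. ?F t y \<partial>lborel) * indicator {0<..} t \<partial>lborel)
          = (\<integral>\<^sup>+t. ennreal (\<phi> x) * ((\<integral>\<^sup>+y. ?F t y \<partial>lborel) * indicator {0<..} t) \<partial>lborel)"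
        by (rule nn_integral_cmult[symmetric]) measurable
      also have "\<dots> = (\<integral>\<^sup>+t. \<integral>\<^sup>+y. ennreal (\<phi> x) * ?F t y * indicator {0<..} t \<partial>lborel \<partial>lborel)"
      proof (intro nn_integral_cong)
        fix t :: real
        have "(\<integral>\<^sup>+y. ennreal (\<phi> x) * ?F t y * indicator {0<..} t \<partial>lborel)
           = (\<integral>\<^sup>+y. ennreal (\<phi> x) * ?F t y \<partial>lborel) * indicator {0<..} t"
          by (rule nn_integral_multc) measurable
        also have "(\<integral>\<^sup>+y. ennreal (\<phi> x) * ?F t y \<partial>lborel) = ennreal (\<phi> x) * (\<integral>\<^sup>+y. ?F t y \<partial>lborel)"
          by (rule nn_integral_cmult) measurable
        finally show "ennreal (\<phi> x) * ((\<integral>\<^sup>+y. ?F t y \<partial>lborel) * indicator {0<..} t)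
           = (\<integral>\<^sup>+y. ennreal (\<phi> x) * ?F t y * indicator {0<..} t \<partial>lborel)"
          by (simp only: mult.assoc)
      qed
      finally show "ennreal (\<phi> x) * (\<integral>\<^sup>+t. (\<integral>\<^sup>+y. ?F t y \<partial>lborel) * indicator {0<..} t \<partial>lborel)
          = (\<integral>\<^sup>+t. \<integral>\<^sup>+y. ennreal (\<phi> x) * ?F t y * indicator {0<..} t \<partial>lborel \<partial>lborel)" .
    qed
    also have "\<dots> = (\<integral>\<^sup>+x. \<integral>\<^sup>+y. \<integral>\<^sup>+t. ennreal (\<phi> x) * (ennreal k * (ennreal (h y) * w t y * indicator (ball x t) y)) * indicator {0<..} t \<partial>lborel \<partial>lborel \<partial>lborel)"
      by (intro nn_integral_cong lborel_pair.Fubini') measurable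
    also have "\<dots> = (\<integral>\<^sup>+y. \<integral>\<^sup>+x. \<integral>\<^sup>+t. ennreal (\<phi> x) * (ennreal k * (ennreal (h y) * w t y * indicator (ball x t) y)) * indicator {0<..} t \<partial>lborel \<partial>lborel \<partial>lborel)"
      by (rule lborel_pair.Fubini') measurable
    also have "\<dots> = (\<integral>\<^sup>+y. \<integral>\<^sup>+t. \<integral>\<^sup>+x. ennreal (\<phi> x) * (ennreal k * (ennreal (h y) * w t y * indicator (ball x t) y)) * indicator {0<..} t \<partial>lborel \<partial>lborel \<partial>lborel)"
      by (intro nn_integral_cong lborel_pair.Fubini') measurable
    also have "\<dots> = (\<integral>\<^sup>+y. \<integral>\<^sup>+t. ennreal k * (ennreal (h y) * (ennreal (avg_weighted (\<lambda>x. infdist x E) b \<phi> y t) * indicator {0<..} t)) \<partial>lborel \<partial>lborel)"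
    proof (intro nn_integral_cong)
      fix y :: 'a and t :: real
      show "(\<integral>\<^sup>+x. ennreal (\<phi> x) * (ennreal k * (ennreal (h y) * w t y * indicator (ball x t) y)) * indicator {0<..} t \<partial>lborel)
         = ennreal k * (ennreal (h y) * (ennreal (avg_weighted (\<lambda>x. infdist x E) b \<phi> y t) * indicator {0<..} t))"
      proof (cases "0 < t")
        case True
        have fin: "(\<integral>\<^sup>+x. ennreal (\<phi> x) * indicator (ball y t) x \<partial>lborel) < \<infinity>"
          using \<phi> r P True unfolding r_def[symmetric] by (intro local_integral_finite[where r=r]) auto
        have "(\<integral>\<^sup>+x. ennreal (\<phi> x) * (ennreal k * (ennreal (h y) * w t y * indicator (ball x t) y)) * indicator {0<..} t \<partial>lborel)
          = (\<integral>\<^sup>+x. (ennreal k * (ennreal (h y) * w t y)) * (ennreal (\<phi> x) * indicator (ball y t) x) \<partial>lborel)"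
          using True by (intro nn_integral_cong) (auto simp: indicator_def dist_commute mult_ac)
        also have "\<dots> = (ennreal k * (ennreal (h y) * w t y)) * (\<integral>\<^sup>+x. ennreal (\<phi> x) * indicator (ball y t) x \<partial>lborel)"
          by (rule nn_integral_cmult) measurable
        also have "\<dots> = (ennreal k * (ennreal (h y) * w t y)) * ennreal (enn2real (\<integral>\<^sup>+x. ennreal (\<phi> x) * indicator (ball y t) x \<partial>lborel))"
          using fin by (simp add: less_top[symmetric])
        also have "\<dots> = ennreal k * (ennreal (h y) * ennreal (avg_weighted (\<lambda>x. infdist x E) b \<phi> y t))"
          unfolding avg_weighted_def w_def n_def by (simp add: ennreal_mult' mult.assoc)
        finally show ?thesis using True by simp
      qed simp
    qed
    also have "\<dots> = ennreal k * (\<integral>\<^sup>+y. ennreal (h y) * (\<integral>\<^sup>+t. ennreal (avg_weighted (\<lambda>x. infdist x E) b \<phi> y t) * indicator {0<..} t \<partial>lborel) \<partial>lborel)"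
      by (simp add: nn_integral_cmult)
    also have "\<dots> \<le> ennreal k * ennreal C"
      using h \<phi> P H unfolding r_def[symmetric] by (intro mult_left_mono C(2)) auto
    also have "\<dots> = ennreal (C * k)" using C k by (simp add: ennreal_mult'[symmetric] mult.commute)
    finally show ?thesis .
  qed
  with C(1) show ?thesis by blast
qed

text \<open>Qualitative finiteness, needed to divide by a power of the integral in the duality argument below. For
\<open>a \<ge> 0\<close> it holds because \<open>\<delta>^(-aq)\<close> is locally integrable, for \<open>a < 0\<close> because the weight is locally bounded.\<close>

lemma weighted_power_integral_finite:
  fixes E :: "'a::euclidean_space set" and u :: "'a \<Rightarrow> real" and a d q :: real
  defines "n \<equiv> real DIM('a)"
  assumes E: "closed E" "E \<noteq> {}" "assouad_dim E = ereal d" "d < n"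
    and u: "continuous_on UNIV u" "bounded {x. u x \<noteq> 0}" and q: "0 < q" and a: "a * q < n - d"
  shows "(\<integral>\<^sup>+x. ennreal ((\<bar>u x\<bar> * infdist x E powr (- a)) powr q) \<partial>lborel) < \<infinity>"
proof -
  define g where "g = max 0 (a * q)"
  have g: "0 \<le> g" "g < n - d" unfolding g_def using a E(4) by auto
  obtain K where K: "K > 0" "\<And>y t. 0 < t \<Longrightarrow>
      (\<integral>\<^sup>+x. ennreal ((1 + t / infdist x E) powr g) * indicator (ball y t) x \<partial>lborel) \<le> ennreal (K * t powr n)"
    using distance_weight_ball_integral'[OF E(1-3) g[unfolded n_def]] unfolding n_def by blast
  obtain t0 where t0: "\<And>x. u x \<noteq> 0 \<Longrightarrow> norm x \<le> t0" using u(2) unfolding bounded_iff by auto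
  define t where "t = \<bar>t0\<bar> + 1"
  have t: "t > 0" "\<And>x. u x \<noteq> 0 \<Longrightarrow> norm x < t" unfolding t_def using t0 by fastforce+
  have "compact (u ` cball 0 t)"
    using u(1) by (intro compact_continuous_image) (auto intro: continuous_on_subset)
  then obtain M where M: "\<And>x. x \<in> cball 0 t \<Longrightarrow> \<bar>u x\<bar> \<le> M"
    using compact_imp_bounded bounded_iff by (metis imageI real_norm_def)
  have M0: "M \<ge> 0" using M[of 0] t by (auto intro: order_trans[OF abs_ge_zero])
  define L where "L = M powr q * (t powr (- g) + (infdist 0 E + t) powr (- a * q))"
  have L0: "L \<ge> 0" unfolding L_def by simp
  have pw: "ennreal ((\<bar>u x\<bar> * infdist x E powr (- a)) powr q)
      \<le> ennreal L * (ennreal ((1 + t / infdist x E) powr g) * indicator (ball 0 t) x)" for x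
  proof (cases "u x = 0 \<or> infdist x E = 0")
    case False
    then have x: "norm x < t" "infdist x E > 0" using t by (auto simp: order_less_le infdist_nonneg)
    have uM: "\<bar>u x\<bar> powr q \<le> M powr q" using M[of x] x q by (intro powr_mono2) auto
    have dle: "infdist x E powr (- a * q) \<le> (t powr (- g) + (infdist 0 E + t) powr (- a * q)) * (1 + t / infdist x E) powr g"
    proof (cases "0 \<le> a")
      case True
      then have ga: "g = a * q" unfolding g_def using q by simp
      have "infdist x E powr (- a * q) = t powr (- g) * (t / infdist x E) powr g"
        unfolding ga using t x by (simp add: powr_divide powr_minus field_simps)
      also have "\<dots> \<le> t powr (- g) * (1 + t / infdist x E) powr g"
        using t x g by (intro mult_left_mono powr_mono2) auto
      also have "\<dots> \<le> (t powr (- g) + (infdist 0 E + t) powr (- a * q)) * (1 + t / infdist x E) powr g"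
        by (intro mult_right_mono) auto
      finally show ?thesis .
    next
      case False
      then have ga: "g = 0" unfolding g_def using q mult_neg_pos[of a q] by simp
      have "infdist x E \<le> infdist 0 E + t"
        using infdist_triangle[of x E 0] x by simp
      then have "infdist x E powr (- a * q) \<le> (infdist 0 E + t) powr (- a * q)"
        using False q x by (intro powr_mono2) (auto simp: mult_nonpos_nonneg)
      moreover have "1 + t / infdist x E > 0" using t x by (intro add_pos_pos) auto
      ultimately show ?thesis unfolding ga by (simp add: add_increasing)
    qed
    have "(\<bar>u x\<bar> * infdist x E powr (- a)) powr q = \<bar>u x\<bar> powr q * infdist x E powr (- a * q)"
      by (simp only: powr_mult powr_powr)
    also have "\<dots> \<le> M powr q * ((t powr (- g) + (infdist 0 E + t) powr (- a * q)) * (1 + t / infdist x E) powr g)"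
      by (intro mult_mono uM dle) auto
    also have "\<dots> = L * (1 + t / infdist x E) powr g" unfolding L_def by (simp only: mult.assoc)
    finally show ?thesis using x L0 by (simp add: ennreal_mult'[symmetric] ennreal_leI)
  qed auto
  have "(\<integral>\<^sup>+x. ennreal ((\<bar>u x\<bar> * infdist x E powr (- a)) powr q) \<partial>lborel)
     \<le> (\<integral>\<^sup>+x. ennreal L * (ennreal ((1 + t / infdist x E) powr g) * indicator (ball 0 t) x) \<partial>lborel)"
    by (intro nn_integral_mono pw)
  also have "\<dots> = ennreal L * (\<integral>\<^sup>+x. ennreal ((1 + t / infdist x E) powr g) * indicator (ball 0 t) x \<partial>lborel)"
    by (rule nn_integral_cmult) measurable
  also have "\<dots> \<le> ennreal L * ennreal (K * t powr n)"
    by (intro mult_left_mono K t) auto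
  also have "\<dots> = ennreal (L * (K * t powr n))" using L0 by (simp add: ennreal_mult')
  finally show ?thesis by (simp add: order.strict_trans1)
qed

text \<open>The test function \<open>\<phi>\<close> is the extremal one, \<open>V^(q-1)\<close> normalised in the dual space, where \<open>V = |u| \<delta>^(-a)\<close>. The
inequality is stated for all \<open>g > 0\<close> above the energy, so that it also covers energy zero, where no
normalisation is possible.\<close>

lemma weighted_sobolev:
  fixes E :: "'a::euclidean_space set" and a d p q :: real
  defines "n \<equiv> real DIM('a)"
  assumes E: "closed E" "E \<noteq> {}" "assouad_dim E = ereal d" "d < n"
    and p: "1 < p" and q: "0 < q" and pq: "1/q = 1/p - 1/n"
    and a: "- ((n - d) * (p - 1) / p) < a" "a * q < n - d"
  shows "\<exists>C>0. \<forall>u g. C_k 1 u \<longrightarrow> bounded {x. u x \<noteq> 0} \<longrightarrow> 0 < g \<longrightarrow>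
    (\<integral>\<^sup>+x. ennreal (norm (grad u x) powr p / infdist x E powr (p * a)) \<partial>lborel) \<le> ennreal g \<longrightarrow>
    (\<integral>\<^sup>+x. ennreal ((\<bar>u x\<bar> * infdist x E powr (- a)) powr q) \<partial>lborel) \<le> ennreal (C * g powr (q / p))"
proof -
  have n: "n > 0" unfolding n_def by simp
  have q1: "1 < q"
  proof -
    have "1/q < 1/p" using pq n by (smt (verit) divide_pos_pos)
    then show ?thesis using p q by (simp add: field_simps)
  qed
  have "\<exists>C>0. \<forall>u h \<phi> k. C_k 1 u \<longrightarrow> bounded {x. u x \<noteq> 0} \<longrightarrow> 0 \<le> k \<longrightarrow>
    h \<in> borel_measurable borel \<longrightarrow> \<phi> \<in> borel_measurable borel \<longrightarrow> (\<forall>x. 0 \<le> h x) \<longrightarrow> (\<forall>x. 0 \<le> \<phi> x) \<longrightarrow>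
    (AE y in lborel. norm (grad u y) = k * (h y * infdist y E powr a)) \<longrightarrow>
    (\<integral>\<^sup>+y. ennreal (h y powr p) \<partial>lborel) \<le> 1 \<longrightarrow> (\<integral>\<^sup>+x. ennreal (\<phi> x powr (q / (q - 1))) \<partial>lborel) \<le> 1 \<longrightarrow>
    (\<integral>\<^sup>+x. ennreal (\<phi> x * (unit_ball_vol n * (\<bar>u x\<bar> * infdist x E powr (- a)))) \<partial>lborel) \<le> ennreal (C * k)"
  proof (cases "0 \<le> a")
    case True
    then show ?thesis
      using dual_bound_nonneg[OF E(1-3) E(4)[unfolded n_def] p q pq[unfolded n_def]] a(2) unfolding n_def by blast
  next
    case False
    have "- a < (n - d) * (p - 1) / p" using a(1) by simp
    then have "- a * (p / (p - 1)) < (n - d) * (p - 1) / p * (p / (p - 1))"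
      using p by (intro mult_strict_right_mono) auto
    also have "\<dots> = n - d" using p by simp
    finally have "- a * (p / (p - 1)) < n - d" .
    then show ?thesis
      using dual_bound_neg[OF E(1-3) E(4)[unfolded n_def] p q1 pq[unfolded n_def], of "- a"] False unfolding n_def by simp
  qed
  then obtain C where C: "C > 0" and dual: "\<And>u h \<phi> k. C_k 1 u \<Longrightarrow> bounded {x. u x \<noteq> 0} \<Longrightarrow> 0 \<le> k \<Longrightarrow>
    h \<in> borel_measurable borel \<Longrightarrow> \<phi> \<in> borel_measurable borel \<Longrightarrow> (\<forall>x. 0 \<le> h x) \<Longrightarrow> (\<forall>x. 0 \<le> \<phi> x) \<Longrightarrow>
    (AE y in lborel. norm (grad u y) = k * (h y * infdist y E powr a)) \<Longrightarrow>
    (\<integral>\<^sup>+y. ennreal (h y powr p) \<partial>lborel) \<le> 1 \<Longrightarrow> (\<integral>\<^sup>+x. ennreal (\<phi> x powr (q / (q - 1))) \<partial>lborel) \<le> 1 \<Longrightarrow>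
    (\<integral>\<^sup>+x. ennreal (\<phi> x * (unit_ball_vol n * (\<bar>u x\<bar> * infdist x E powr (- a)))) \<partial>lborel) \<le> ennreal (C * k)"
    by blast
  define v where "v = unit_ball_vol n"
  have v: "v > 0" unfolding v_def using n by (simp add: unit_ball_vol_pos)
  have "(\<integral>\<^sup>+x. ennreal ((\<bar>u x\<bar> * infdist x E powr (- a)) powr q) \<partial>lborel) \<le> ennreal ((C / v) powr q * g powr (q / p))"
    if u: "C_k 1 u" "bounded {x. u x \<noteq> 0}" and g: "0 < g"
      and G: "(\<integral>\<^sup>+x. ennreal (norm (grad u x) powr p / infdist x E powr (p * a)) \<partial>lborel) \<le> ennreal g" for u g
  proof -
    have [measurable]: "grad u \<in> borel_measurable borel"
      using C_1_gradient(2)[OF u(1)] by (rule borel_measurable_continuous_onI)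
    have ucont: "continuous_on UNIV u"
      using C_1_gradient(1)[OF u(1)] by (meson continuous_at_imp_continuous_on has_derivative_continuous)
    have [measurable]: "u \<in> borel_measurable borel"
      using ucont by (rule borel_measurable_continuous_onI)
    define V where "V x = \<bar>u x\<bar> * infdist x E powr (- a)" for x
    have V0: "0 \<le> V x" for x unfolding V_def by simp
    have [measurable]: "V \<in> borel_measurable borel" unfolding V_def by measurable
    have "(\<integral>\<^sup>+x. ennreal (V x powr q) \<partial>lborel) < \<infinity>"
      unfolding V_def using E a q u(2) ucont unfolding n_def by (intro weighted_power_integral_finite) auto
    then obtain S where S: "(\<integral>\<^sup>+x. ennreal (V x powr q) \<partial>lborel) = ennreal S" "0 \<le> S"
      by (cases "\<integral>\<^sup>+x. ennreal (V x powr q) \<partial>lborel") auto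
    have "S \<le> (C / v) powr q * g powr (q / p)"
    proof (cases "S = 0")
      case False
      then have S0: "S > 0" using S by simp
      define k where "k = g powr (1 / p)"
      have k: "k > 0" unfolding k_def using g by simp
      define h where "h y = norm (grad u y) * infdist y E powr (- a) / k" for y
      define c where "c = S powr (1 - 1/q)"
      have c: "c > 0" unfolding c_def using S0 by simp
      define \<phi> where "\<phi> x = V x powr (q - 1) / c" for x
      have [measurable]: "h \<in> borel_measurable borel" "\<phi> \<in> borel_measurable borel"
        unfolding h_def \<phi>_def by measurable
      have h0: "0 \<le> h y" for y unfolding h_def using k by simp
      have \<phi>0: "0 \<le> \<phi> y" for y unfolding \<phi>_def using c by simp
      have pos: "AE y in lborel. 0 < infdist y E"
        using E unfolding n_def by (intro AE_infdist_pos) auto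
      have gr: "AE y in lborel. norm (grad u y) = k * (h y * infdist y E powr a)"
        using pos
      proof eventually_elim
        fix y assume "0 < infdist y E"
        then have "infdist y E powr (- a) * infdist y E powr a = 1" by (simp add: powr_add[symmetric])
        then show "norm (grad u y) = k * (h y * infdist y E powr a)"
          unfolding h_def using k by simp
      qed
      have hp: "(\<integral>\<^sup>+y. ennreal (h y powr p) \<partial>lborel) \<le> 1"
      proof -
        have "h y powr p = norm (grad u y) powr p / infdist y E powr (p * a) * (1 / g)" for y
        proof -
          have "h y powr p = norm (grad u y) powr p * infdist y E powr (- a * p) / k powr p"
            unfolding h_def by (simp only: powr_mult powr_divide powr_powr)
          also have "k powr p = g" unfolding k_def using g p by (simp add: powr_powr)
          finally show ?thesis by (simp add: powr_minus field_simps)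
        qed
        then have "(\<integral>\<^sup>+y. ennreal (h y powr p) \<partial>lborel)
          = (\<integral>\<^sup>+y. ennreal (norm (grad u y) powr p / infdist y E powr (p * a)) * ennreal (1 / g) \<partial>lborel)"
          using g by (simp add: ennreal_mult''[symmetric])
        also have "\<dots> = (\<integral>\<^sup>+y. ennreal (norm (grad u y) powr p / infdist y E powr (p * a)) \<partial>lborel) * ennreal (1 / g)"
          by (rule nn_integral_multc) measurable
        also have "\<dots> \<le> ennreal g * ennreal (1 / g)" by (intro mult_right_mono G) auto
        also have "\<dots> = 1" using g by (simp add: ennreal_mult''[symmetric])
        finally show ?thesis .
      qed
      have \<phi>q: "(\<integral>\<^sup>+x. ennreal (\<phi> x powr (q / (q - 1))) \<partial>lborel) \<le> 1"
      proof -
        have e: "(q - 1) * (q / (q - 1)) = q" "(1 - 1/q) * (q / (q - 1)) = 1" using q1 by (auto simp: field_simps)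
        have "\<phi> x powr (q / (q - 1)) = V x powr q * (1 / S)" for x
          unfolding \<phi>_def c_def using S0 by (simp only: powr_divide powr_powr e) simp
        then have "(\<integral>\<^sup>+x. ennreal (\<phi> x powr (q / (q - 1))) \<partial>lborel) = (\<integral>\<^sup>+x. ennreal (V x powr q) * ennreal (1 / S) \<partial>lborel)"
          using S0 by (simp add: ennreal_mult''[symmetric])
        also have "\<dots> = (\<integral>\<^sup>+x. ennreal (V x powr q) \<partial>lborel) * ennreal (1 / S)"
          by (rule nn_integral_multc) measurable
        also have "\<dots> = 1" unfolding S(1) using S0 by (simp add: ennreal_mult''[symmetric])
        finally show ?thesis by simp
      qed
      have "ennreal (v * S powr (1 / q)) = ennreal (v / c) * ennreal S"
      proof -
        have "S powr (1/q) = S / c" unfolding c_def using S0 by (simp add: powr_diff)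
        then show ?thesis using v c S by (simp add: ennreal_mult'[symmetric])
      qed
      also have "\<dots> = (\<integral>\<^sup>+x. ennreal (v / c) * ennreal (V x powr q) \<partial>lborel)"
        unfolding S(1)[symmetric] by (rule nn_integral_cmult[symmetric]) measurable
      also have "\<dots> = (\<integral>\<^sup>+x. ennreal (\<phi> x * (unit_ball_vol n * (\<bar>u x\<bar> * infdist x E powr (- a)))) \<partial>lborel)"
      proof (intro nn_integral_cong)
        fix x
        have "V x powr (q - 1) * V x = V x powr q"
          using V0[of x] by (cases "V x = 0") (auto simp: powr_diff)
        then have "v / c * V x powr q = \<phi> x * (v * V x)" unfolding \<phi>_def by (simp add: field_simps)
        then show "ennreal (v / c) * ennreal (V x powr q) = ennreal (\<phi> x * (unit_ball_vol n * (\<bar>u x\<bar> * infdist x E powr (- a))))"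
          using v c unfolding v_def[symmetric] V_def[symmetric] by (simp add: ennreal_mult'[symmetric])
      qed
      also have "\<dots> \<le> ennreal (C * k)"
        using u k h0 \<phi>0 gr hp \<phi>q by (intro dual) auto
      finally have "v * S powr (1/q) \<le> C * k" using C k by (simp add: ennreal_le_iff)
      then have "S powr (1/q) \<le> C / v * k" using v by (simp add: field_simps)
      then have "(S powr (1/q)) powr q \<le> (C / v * k) powr q" using q by (intro powr_mono2) auto
      also have "\<dots> = (C / v) powr q * g powr (q / p)"
      proof -
        have "k powr q = g powr (1 / p * q)" unfolding k_def by (rule powr_powr)
        then show ?thesis by (subst powr_mult) simp
      qed
      finally show ?thesis using q S0 by (simp add: powr_powr)
    qed simp
    then show ?thesis unfolding V_def[symmetric] S(1) by (rule ennreal_leI)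
  qed
  moreover have "(C / v) powr q > 0" using C v by simp
  ultimately show ?thesis by blast
qed

section \<open>From the Sobolev inequality to the logarithm\<close>

lemma ext_integral_nonneg:
  assumes "\<And>x. 0 \<le> f x"
  shows "ext_integral f = enn2ereal (\<integral>\<^sup>+x. ennreal (f x) \<partial>lborel)"
proof -
  have "ennreal (- f x) = 0" for x using assms by (simp add: ennreal_neg)
  then show ?thesis unfolding ext_integral_def by (simp add: zero_ennreal.rep_eq)
qed

text \<open>An integrable majorant makes the positive part integrable. If the negative part is not, the extended integral is
\<open>-\<infinity>\<close>.\<close>

lemma ext_integral_le_integral:
  fixes f h :: "'a::euclidean_space \<Rightarrow> real"
  assumes [measurable]: "f \<in> borel_measurable borel" and h: "integrable lborel h" and le: "\<And>x. f x \<le> h x"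
  shows "ext_integral f \<le> ereal (integral\<^sup>L lborel h)"
proof -
  have "(\<integral>\<^sup>+x. ennreal (f x) \<partial>lborel) \<le> (\<integral>\<^sup>+x. ennreal (norm (h x)) \<partial>lborel)"
    using le by (intro nn_integral_mono ennreal_leI) (smt (verit) real_norm_def)
  also have "\<dots> < \<infinity>" using h by (simp add: integrable_iff_bounded)
  finally have fin: "(\<integral>\<^sup>+x. ennreal (f x) \<partial>lborel) < \<infinity>" .
  then obtain s where s: "(\<integral>\<^sup>+x. ennreal (f x) \<partial>lborel) = ennreal s" "0 \<le> s"
    by (cases "\<integral>\<^sup>+x. ennreal (f x) \<partial>lborel") auto
  show ?thesis
  proof (cases "\<integral>\<^sup>+x. ennreal (- f x) \<partial>lborel")
    case (real m)
    have int: "integrable lborel f"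
      using real s by (intro real_integrable_def[THEN iffD2]) auto
    have "integral\<^sup>L lborel f = s - m"
      unfolding real_lebesgue_integral_def[OF int] s real(2) using s real(1) by simp
    moreover have "integral\<^sup>L lborel f \<le> integral\<^sup>L lborel h"
      using int h le by (intro integral_mono) auto
    ultimately show ?thesis unfolding ext_integral_def s real(2) using s real(1) by (simp add: enn2ereal_ennreal)
  next
    case top
    then show ?thesis unfolding ext_integral_def s(1) using s(2) by (simp add: enn2ereal_ennreal)
  qed
qed

text \<open>The tangent-line bound \<open>ln z \<le> z - 1\<close> at \<open>z = w^\<theta> / S\<close>: integrated against a probability density \<open>f\<close> with
\<open>S\<close> the integral of \<open>f w^\<theta>\<close>, it is Jensen's inequality.\<close>

lemma jensen_log_pointwise:
  fixes f y S \<theta> w :: real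
  assumes "0 \<le> f" "0 < w" "0 < \<theta>" "0 < S"
  shows "f * ln w \<le> (f * w powr \<theta> / S + f * (ln S - 1)) / \<theta>"
proof -
  have "ln (w powr \<theta> / S) \<le> w powr \<theta> / S - 1"
    using assms by (intro ln_le_minus_one) auto
  then have "\<theta> * ln w \<le> w powr \<theta> / S + (ln S - 1)"
    using assms by (simp add: ln_div ln_powr)
  then have "ln w \<le> (w powr \<theta> / S + (ln S - 1)) / \<theta>"
    using assms by (simp add: field_simps)
  then have "f * ln w \<le> f * ((w powr \<theta> / S + (ln S - 1)) / \<theta>)"
    using assms by (intro mult_left_mono)
  then show ?thesis by (simp add: algebra_simps add_divide_distrib)
qed

text \<open>Where \<open>f\<close> is nonzero, so are \<open>u\<close> and the distance, and there \<open>f w^(p/(n-p))\<close> is the integrand of \<open>S\<close>. Elsewhere all integrands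
are handled by \<open>f = 0\<close>, in particular on \<open>E\<close>, where the quotients and powers take their default value 0.\<close>

lemma entropy_le_log_power:
  fixes E :: "'a::euclidean_space set" and u :: "'a \<Rightarrow> real" and p a S :: real
  defines "n \<equiv> real DIM('a)"
  defines "q \<equiv> n * p / (n - p)"
  assumes p: "1 < p" "p < n" and [measurable]: "u \<in> borel_measurable borel"
    and norm1: "(\<integral>\<^sup>+x. ennreal (\<bar>u x\<bar> powr p / infdist x E powr (p * (a + 1))) \<partial>lborel) = 1"
    and S: "(\<integral>\<^sup>+x. ennreal ((\<bar>u x\<bar> * infdist x E powr (- a)) powr q) \<partial>lborel) = ennreal S" "0 \<le> S"
  shows "0 < S"
    and "ext_integral (\<lambda>x. \<bar>u x\<bar> powr p / infdist x E powr (p * (a + 1))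
        * ln (infdist x E powr (n - p - p * a) * \<bar>u x\<bar> powr p)) \<le> ereal ((n - p) / p * ln S)"
proof -
  define f where "f x = \<bar>u x\<bar> powr p / infdist x E powr (p * (a + 1))" for x
  define V where "V x = (\<bar>u x\<bar> * infdist x E powr (- a)) powr q" for x
  define w where "w x = infdist x E powr (n - p - p * a) * \<bar>u x\<bar> powr p" for x
  have [measurable]: "f \<in> borel_measurable borel" "V \<in> borel_measurable borel" "w \<in> borel_measurable borel"
    unfolding f_def V_def w_def by measurable
  have f0: "0 \<le> f x" and V0: "0 \<le> V x" for x unfolding f_def V_def by auto
  have fV: "f x = 0 \<or> (0 < w x \<and> 0 < V x \<and> f x * w x powr (p / (n - p)) = V x)" for x
  proof (cases "u x = 0 \<or> infdist x E = 0")
    case False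
    then have pos: "\<bar>u x\<bar> > 0" "infdist x E > 0" by (auto simp: order_less_le infdist_nonneg)
    have e1: "p + p * (p / (n - p)) = q" unfolding q_def using p by (simp add: field_simps)
    have e2: "- (p * (a + 1)) + (n - p - p * a) * (p / (n - p)) = - a * q"
      unfolding q_def using p by (simp add: field_simps)
    have "f x * w x powr (p / (n - p)) = (\<bar>u x\<bar> powr p * \<bar>u x\<bar> powr (p * (p / (n - p)))) *
       (infdist x E powr (- (p * (a + 1))) * infdist x E powr ((n - p - p * a) * (p / (n - p))))"
      unfolding f_def w_def by (simp only: powr_mult powr_powr powr_minus divide_inverse mult_ac)
    also have "\<dots> = \<bar>u x\<bar> powr q * infdist x E powr (- a * q)"
      by (simp only: powr_add[symmetric] e1 e2)
    also have "\<dots> = V x" unfolding V_def by (simp only: powr_mult powr_powr)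
    finally show ?thesis using pos unfolding w_def V_def by auto
  qed (auto simp: f_def)
  show "0 < S"
  proof (rule ccontr)
    assume "\<not> 0 < S"
    then have "(\<integral>\<^sup>+x. ennreal (V x) \<partial>lborel) = 0" using S unfolding V_def by simp
    then have "AE x in lborel. ennreal (V x) = 0" by (subst (asm) nn_integral_0_iff_AE) auto
    then have "AE x in lborel. ennreal (f x) = 0"
    proof eventually_elim
      fix x assume "ennreal (V x) = 0"
      then have "V x = 0" using V0[of x] by simp
      then have "f x = 0" using fV[of x] by auto
      then show "ennreal (f x) = 0" by simp
    qed
    then have "(\<integral>\<^sup>+x. ennreal (f x) \<partial>lborel) = 0" by (subst nn_integral_0_iff_AE) auto
    with norm1 show False unfolding f_def by simp
  qed
  define \<theta> where "\<theta> = p / (n - p)"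
  have \<theta>: "\<theta> > 0" unfolding \<theta>_def using p by simp
  define H where "H x = (V x / S + f x * (ln S - 1)) / \<theta>" for x
  have fb: "has_bochner_integral lborel f 1"
    using norm1 f0 unfolding f_def[symmetric] by (intro has_bochner_integral_nn_integral) auto
  have Vb: "has_bochner_integral lborel V S"
    using S V0 unfolding V_def[symmetric] by (intro has_bochner_integral_nn_integral) auto
  have "has_bochner_integral lborel (\<lambda>x. (V x / S + f x * (ln S - 1)) / \<theta>) ((S / S + 1 * (ln S - 1)) / \<theta>)"
    by (intro has_bochner_integral_divide has_bochner_integral_add has_bochner_integral_mult_left fb Vb)
  then have Hb: "has_bochner_integral lborel H (ln S / \<theta>)" unfolding H_def using \<open>0 < S\<close> by simp
  have "ext_integral (\<lambda>x. f x * ln (w x)) \<le> ereal (integral\<^sup>L lborel H)"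
  proof (rule ext_integral_le_integral)
    show "integrable lborel H" using Hb by (simp add: has_bochner_integral_iff)
    show "f x * ln (w x) \<le> H x" for x
    proof (cases "f x = 0")
      case True
      then show ?thesis unfolding H_def using V0[of x] \<open>0 < S\<close> \<theta> by simp
    next
      case False
      then have "0 < w x" "f x * w x powr \<theta> = V x" using fV[of x] unfolding \<theta>_def by auto
      then show ?thesis
        using jensen_log_pointwise[OF f0[of x] _ \<theta> \<open>0 < S\<close>, of "w x"] unfolding H_def by simp
    qed
  qed measurable
  also have "integral\<^sup>L lborel H = (n - p) / p * ln S"
    using has_bochner_integral_integral_eq[OF Hb] unfolding \<theta>_def by simp
  finally show "ext_integral (\<lambda>x. \<bar>u x\<bar> powr p / infdist x E powr (p * (a + 1))
        * ln (infdist x E powr (n - p - p * a) * \<bar>u x\<bar> powr p)) \<le> ereal ((n - p) / p * ln S)"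
    unfolding f_def w_def .
qed

theorem theorem1p3:
  fixes N :: nat and p d a :: real and E :: "(real ^ 'n) set"
  assumes "CARD('n) = N" and "N \<ge> 3"
    and "1 < p" and "p < real N"
    and "closed E" and "E \<noteq> {}"
    and "assouad_dim E = ereal d" and "d < real N"
    and "- ((real N - d) * (p - 1) / p) < a"
    and "a < (real N - p) * (real N - d) / (real N * p)"
  shows "\<exists>C>0. \<forall>u :: real ^ 'n \<Rightarrow> real. u \<in> Cc_infinity \<longrightarrow>
    ext_integral (\<lambda>x. \<bar>u x\<bar> powr p / infdist x E powr (p * (a + 1))) = 1 \<longrightarrow>
    ext_integral (\<lambda>x. \<bar>u x\<bar> powr p / infdist x E powr (p * (a + 1))
        * ln (infdist x E powr (real N - p - p * a) * \<bar>u x\<bar> powr p))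
      \<le> ereal (real N / p) *
        ext_ln (ereal C * ext_integral (\<lambda>x. norm (grad u x) powr p / infdist x E powr (p * a)))"
proof -
  have N: "real DIM(real ^ 'n) = real N" using assms(1) by simp
  have Npos: "real N > 0" using assms(2) by simp
  define q where "q = real N * p / (real N - p)"
  have q: "0 < q" unfolding q_def using assms(3,4) Npos by simp
  have pq: "1 / q = 1 / p - 1 / real N" unfolding q_def using assms(3,4) Npos by (simp add: field_simps)
  have "a * q < (real N - p) * (real N - d) / (real N * p) * q"
    using assms(10) q by (rule mult_strict_right_mono)
  also have "\<dots> = real N - d" unfolding q_def using assms(3,4) Npos by simp
  finally have aq: "a * q < real N - d" .
  obtain C where C: "C > 0" and sob: "\<And>u g. C_k 1 u \<Longrightarrow> bounded {x. u x \<noteq> 0} \<Longrightarrow> 0 < g \<Longrightarrow>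
    (\<integral>\<^sup>+x. ennreal (norm (grad u x) powr p / infdist x E powr (p * a)) \<partial>lborel) \<le> ennreal g \<Longrightarrow>
    (\<integral>\<^sup>+x. ennreal ((\<bar>u x\<bar> * infdist x E powr (- a)) powr q) \<partial>lborel) \<le> ennreal (C * g powr (q / p))"
    using weighted_sobolev[OF assms(5,6,7), of p q a] assms(3,8,9) q pq aq unfolding N by blast
  define C' where "C' = C powr (p / q)"
  have C': "C' > 0" unfolding C'_def using C by simp
  have "ext_integral (\<lambda>x. \<bar>u x\<bar> powr p / infdist x E powr (p * (a + 1))
        * ln (infdist x E powr (real N - p - p * a) * \<bar>u x\<bar> powr p))
      \<le> ereal (real N / p) *
        ext_ln (ereal C' * ext_integral (\<lambda>x. norm (grad u x) powr p / infdist x E powr (p * a)))"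
    if u: "u \<in> Cc_infinity"
      and norm1: "ext_integral (\<lambda>x. \<bar>u x\<bar> powr p / infdist x E powr (p * (a + 1))) = 1" for u :: "real ^ 'n \<Rightarrow> real"
  proof -
    have u1: "C_k 1 u" and ub: "bounded {x. u x \<noteq> 0}"
      using u unfolding Cc_infinity_def by (auto dest: compact_imp_bounded intro: bounded_subset closure_subset)
    have "continuous_on UNIV u"
      using C_1_gradient(1)[OF u1] by (meson continuous_at_imp_continuous_on has_derivative_continuous)
    then have um[measurable]: "u \<in> borel_measurable borel" by (rule borel_measurable_continuous_onI)
    have n1: "(\<integral>\<^sup>+x. ennreal (\<bar>u x\<bar> powr p / infdist x E powr (p * (a + 1))) \<partial>lborel) = 1"
    proof -
      have "enn2ereal (\<integral>\<^sup>+x. ennreal (\<bar>u x\<bar> powr p / infdist x E powr (p * (a + 1))) \<partial>lborel) = enn2ereal 1"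
        using norm1 by (subst (asm) ext_integral_nonneg) (auto simp: one_ennreal.rep_eq)
      then show ?thesis by (simp only: enn2ereal_inject)
    qed
    define G where "G = (\<integral>\<^sup>+x. ennreal (norm (grad u x) powr p / infdist x E powr (p * a)) \<partial>lborel)"
    have extG: "ext_integral (\<lambda>x. norm (grad u x) powr p / infdist x E powr (p * a)) = enn2ereal G"
      unfolding G_def by (rule ext_integral_nonneg) simp
    show ?thesis
    proof (cases G)
      case top
      then show ?thesis unfolding extG using C' assms(3) Npos by (simp add: ext_ln_def)
    next
      case (real g)
      have le: "(\<integral>\<^sup>+x. ennreal ((\<bar>u x\<bar> * infdist x E powr (- a)) powr q) \<partial>lborel) \<le> ennreal (C * g' powr (q / p))"
        if "0 < g'" "g \<le> g'" for g'
        using that real sob[OF u1 ub, of g'] unfolding G_def by (simp add: ennreal_leI)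
      have "(\<integral>\<^sup>+x. ennreal ((\<bar>u x\<bar> * infdist x E powr (- a)) powr q) \<partial>lborel) < \<infinity>"
        using le[of "g + 1"] real by (simp add: order.strict_trans1)
      then obtain S where S: "(\<integral>\<^sup>+x. ennreal ((\<bar>u x\<bar> * infdist x E powr (- a)) powr q) \<partial>lborel) = ennreal S" "0 \<le> S"
        by (cases "\<integral>\<^sup>+x. ennreal ((\<bar>u x\<bar> * infdist x E powr (- a)) powr q) \<partial>lborel") auto
      note ent = entropy_le_log_power[of p u E a S, unfolded N, OF assms(3,4) um n1 S[unfolded q_def]]
      have S0: "0 < S" by (rule ent(1))
      have Sle: "S \<le> C * g' powr (q / p)" if "0 < g'" "g \<le> g'" for g'
        using le[OF that] C unfolding S by simp
      have g0: "g > 0"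
      proof (rule ccontr)
        assume "\<not> g > 0"
        then have "g = 0" using real by simp
        \<comment> \<open>an energy bound so small that the Sobolev inequality would give \<open>S \<le> S / 2\<close>\<close>
        define g' where "g' = (S / (2 * C)) powr (p / q)"
        have "g' > 0" unfolding g'_def using S0 C by simp
        then have "S \<le> C * g' powr (q / p)" using \<open>g = 0\<close> by (intro Sle) auto
        also have "g' powr (q / p) = S / (2 * C)"
          unfolding g'_def using S0 C q assms(3) by (simp add: powr_powr)
        finally show False using C S0 by simp
      qed
      have "ln S \<le> ln (C * g powr (q / p))" using Sle[OF g0] S0 by simp
      also have "\<dots> = q / p * ln (C' * g)"
        unfolding C'_def using C g0 q assms(3) by (simp add: ln_mult ln_powr algebra_simps)
      finally have "(real N - p) / p * ln S \<le> (real N - p) / p * (q / p * ln (C' * g))"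
        using assms(3,4) by (intro mult_left_mono) auto
      also have "\<dots> = real N / p * ln (C' * g)" unfolding q_def using assms(3,4) by simp
      finally have "ereal ((real N - p) / p * ln S) \<le> ereal (real N / p * ln (C' * g))" by simp
      also have "\<dots> = ereal (real N / p) * ext_ln (ereal C' * enn2ereal G)"
        using mult_pos_pos[OF C' g0] g0 unfolding ext_ln_def real(2) by (simp add: enn2ereal_ennreal)
      finally show ?thesis unfolding extG by (rule order_trans[OF ent(2)])
    qed
  qed
  with C' show ?thesis by blast
qed

end
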